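(* Let $\mathcal F \subsetneq [P_{n+l-1}]_{\ge l}$ be a lower filter with complement $\mathcal F^{\mathsf c} := [P_{n+l-1}]_{\ge l}\setminus \mathcal F$. Then $I_{l,\mathcal F}=J_{l,\mathcal F^{\mathsf c}}$, and $I_{l,\mathcal F}$ is a radical ideal. In particular, for $\lambda\in[P_{n+l-1}]_{\ge l}$, the ideal $I_{l,\lambda}$ is a radical ideal with $$I_{l,\lambda}=\{f\in S\mid f(\mathbf a)=0 \text{ for all } \mathbf a\in K^n \text{ with } \Lambda_l(\mathbf a)\not\unlhd\lambda\},$$ for which $\{f_T\mid T\in\mathrm{STab}(l,\mu),\ \mu\in[P_{n+l-1}]_{\ge l},\ \mu\unlhd\lambda\}$ forms a Gröbner basis with respect to the lexicographic order with $x_1<\cdots<x_n$.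
   Context: $K$ is an infinite field, $n,l\ge 1$ are integers, $S=K[x_1,\ldots,x_n]$. $P_m$ is the set of partitions of $m$ (non-increasing sequences of positive integers with sum $m$). The dominance order on $P_m$: for $\lambda=(\lambda_1,\ldots,\lambda_p)$, $\mu=(\mu_1,\ldots,\mu_q)$, $\lambda\unrhd\mu$ (equivalently $\mu\unlhd\lambda$) iff $\lambda_1+\cdots+\lambda_i\ge\mu_1+\cdots+\mu_i$ for $1\le i\le\min\{p,q\}$. $[P_{n+l-1}]_{\ge l}:=\{\lambda\in P_{n+l-1}\mid \lambda_1\ge l\}$, a subposet of $P_{n+l-1}$. A subset $\mathcal F\subset[P_{n+l-1}]_{\ge l}$ is a lower (resp. upper) filter if $\lambda\in\mathcal F$, $\mu\in[P_{n+l-1}]_{\ge l}$ and $\mu\unlhd\lambda$ (resp. $\mu\unrhd\lambda$) imply $\mu\in\mathcal F$. For $\lambda\in[P_{n+l-1}]_{\ge l}$, $\mathrm{Tab}(l,\lambda)$ is the set of bijective fillings $T$ of the squares of the Young diagram of $\lambda$ by the multiset consisting of $l$ copies of $1$ and one copy of each of $2,\ldots,n$, such that no two copies of $1$ lie in the same column. If $a_1,\ldots,a_r$ are the entries of a column from top to bottom, its difference product is $\prod_{1\le i<j\le r}(x_{a_i}-x_{a_j})$; the Specht polynomial $f_T$ is the product of the difference products of all columns of $T$. $T$ is standard if its columns are strictly increasing from top to bottom and its rows are non-decreasing from left to right; $\mathrm{STab}(l,\lambda)$ is the set of standard $T\in\mathrm{Tab}(l,\lambda)$. $I_{l,\lambda}:=(f_T\mid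 T\in\mathrm{Tab}(l,\lambda))\subset S$, and for a lower filter $\mathcal F$, $I_{l,\mathcal F}:=\sum_{\lambda\in\mathcal F}I_{l,\lambda}$ ($I_{l,\emptyset}=(0)$). For $\mathbf a=(a_1,\ldots,a_n)\in K^n$, $\Lambda_l(\mathbf a)\in[P_{n+l-1}]_{\ge l}$ is the partition of $n+l-1$ whose parts are the multiplicities of the distinct values in the sequence $(a_1,\ldots,a_1,a_2,\ldots,a_n)$ in which $a_1$ is written $l$ times. For an upper filter $\mathcal F'$, $J_{l,\mathcal F'}$ is the ideal of all $f\in S$ with $f(\mathbf a)=0$ for every $\mathbf a\in K^n$ with $\Lambda_l(\mathbf a)\in\mathcal F'$. *)

theory Defs
  imports "HOL-Library.Poly_Mapping" "HOL-Library.FuncSet" "HOL-Library.Multiset"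
    "HOL-Algebra.Ideal"
begin

section \<open>The polynomial ring in \<open>n\<close> variables\<close>

text \<open>
  A polynomial is a finitely supported function from exponent vectors to coefficients, with
  the multiplication (convolution) of \<^theory>\<open>HOL-Library.Poly_Mapping\<close>. The type provides
  variables indexed by all natural numbers; the ring in the variables with indices
  \<open>1, \<dots>, n\<close> is the subring \<open>poly_ring n\<close>, so that ideals are ideals of that ring.
\<close>

type_synonym exponent = "nat \<Rightarrow>\<^sub>0 nat"
type_synonym 'k mpoly = "exponent \<Rightarrow>\<^sub>0 'k"

definition poly_ring :: "nat \<Rightarrow> ('k::field) mpoly ring" where
  "poly_ring n =
     \<lparr>carrier = {p. \<forall>m \<in> Poly_Mapping.keys p. Poly_Mapping.keys m \<subseteq> {1..n}},
      monoid.mult = (*), one = 1, zero = 0, add = (+)\<rparr>"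

definition X :: "nat \<Rightarrow> ('k::field) mpoly" where
  "X i = Poly_Mapping.single (Poly_Mapping.single i 1) 1"

definition eval_mpoly :: "(nat \<Rightarrow> 'k) \<Rightarrow> ('k::field) mpoly \<Rightarrow> 'k" where
  "eval_mpoly a p =
     (\<Sum>m \<in> Poly_Mapping.keys p.
        Poly_Mapping.lookup p m * (\<Prod>i \<in> Poly_Mapping.keys m. a i ^ Poly_Mapping.lookup m i))"

definition affine_space :: "nat \<Rightarrow> (nat \<Rightarrow> 'k) set" where
  "affine_space n = {1..n} \<rightarrow>\<^sub>E UNIV"

definition radical_ideal :: "'a set \<Rightarrow> ('a, 'b) ring_scheme \<Rightarrow> bool" where
  "radical_ideal I R \<longleftrightarrow>
     ideal I R \<and> (\<forall>f \<in> carrier R. \<forall>k::nat. f [^]\<^bsub>R\<^esub> k \<in> I \<longrightarrow> f \<in> I)"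

section \<open>Groebner bases for the lexicographic order\<close>

text \<open>
  The largest variable is the one with the largest index, so the exponents of the variable
  with the largest index at which the two monomials differ decide.
\<close>

definition lex_less :: "exponent \<Rightarrow> exponent \<Rightarrow> bool" where
  "lex_less u v \<longleftrightarrow>
     (\<exists>i. Poly_Mapping.lookup u i < Poly_Mapping.lookup v i \<and> (\<forall>j > i. Poly_Mapping.lookup u j = Poly_Mapping.lookup v j))"

text \<open>Only meaningful for nonzero polynomials.\<close>

definition initial_monomial :: "('k::field) mpoly \<Rightarrow> 'k mpoly" where
  "initial_monomial p =
     Poly_Mapping.single
       (THE m. m \<in> Poly_Mapping.keys p \<and> (\<forall>m' \<in> Poly_Mapping.keys p. m' \<noteq> m \<longrightarrow> lex_less m' m)) 1"

definition initial_ideal :: "nat \<Rightarrow> ('k::field) mpoly set \<Rightarrow> 'k mpoly set" where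
  "initial_ideal n A = Idl\<^bsub>poly_ring n\<^esub> {initial_monomial f | f. f \<in> A \<and> f \<noteq> 0}"

definition is_groebner_basis ::
    "nat \<Rightarrow> ('k::field) mpoly set \<Rightarrow> 'k mpoly set \<Rightarrow> bool" where
  "is_groebner_basis n G I \<longleftrightarrow>
     finite G \<and> G \<subseteq> I \<and> initial_ideal n G = initial_ideal n I"

section \<open>Partitions and filters\<close>

definition partitions :: "nat \<Rightarrow> nat list set" where
  "partitions m =
     {lam. sorted_wrt (\<ge>) lam \<and> (\<forall>x \<in> set lam. 0 < x) \<and> sum_list lam = m}"

text \<open>\<open>dominated mu lam\<close> means that \<open>lam\<close> dominates \<open>mu\<close>.\<close>

definition dominated :: "nat list \<Rightarrow> nat list \<Rightarrow> bool" where
  "dominated mu lam \<longleftrightarrow>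
     (\<forall>i. 1 \<le> i \<and> i \<le> min (length lam) (length mu) \<longrightarrow>
        sum_list (take i mu) \<le> sum_list (take i lam))"

definition partitions_ge :: "nat \<Rightarrow> nat \<Rightarrow> nat list set" where
  "partitions_ge n l = {lam \<in> partitions (n + l - 1). l \<le> hd lam}"

definition lower_filter :: "nat \<Rightarrow> nat \<Rightarrow> nat list set \<Rightarrow> bool" where
  "lower_filter n l F \<longleftrightarrow>
     F \<subseteq> partitions_ge n l \<and>
     (\<forall>lam \<in> F. \<forall>mu \<in> partitions_ge n l. dominated mu lam \<longrightarrow> mu \<in> F)"

section \<open>Tableaux and Specht polynomials\<close>

text \<open>The square \<open>(i, j)\<close> lies in row \<open>i\<close> and column \<open>j\<close>, both counted from \<open>0\<close>.\<close>

definition diagram :: "nat list \<Rightarrow> (nat \<times> nat) set" where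
  "diagram lam = {(i, j). i < length lam \<and> j < lam ! i}"

definition tableaux :: "nat \<Rightarrow> nat \<Rightarrow> nat list \<Rightarrow> (nat \<times> nat \<Rightarrow> nat) set" where
  "tableaux n l lam =
     {T \<in> extensional (diagram lam).
        image_mset T (mset_set (diagram lam)) = replicate_mset l 1 + mset_set {2..n} \<and>
        (\<forall>i i' j. (i, j) \<in> diagram lam \<and> (i', j) \<in> diagram lam \<and>
           T (i, j) = 1 \<and> T (i', j) = 1 \<longrightarrow> i = i')}"

definition standard_tableaux :: "nat \<Rightarrow> nat \<Rightarrow> nat list \<Rightarrow> (nat \<times> nat \<Rightarrow> nat) set" where
  "standard_tableaux n l lam =
     {T \<in> tableaux n l lam.
        (\<forall>i i' j. (i, j) \<in> diagram lam \<and> (i', j) \<in> diagram lam \<and> i < i' \<longrightarrow>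
           T (i, j) < T (i', j)) \<and>
        (\<forall>i j j'. (i, j) \<in> diagram lam \<and> (i, j') \<in> diagram lam \<and> j < j' \<longrightarrow>
           T (i, j) \<le> T (i, j'))}"

definition column_product ::
    "nat list \<Rightarrow> (nat \<times> nat \<Rightarrow> nat) \<Rightarrow> nat \<Rightarrow> ('k::field) mpoly" where
  "column_product lam T j =
     (\<Prod>(i, i') \<in> {(i, i'). i < i' \<and> (i, j) \<in> diagram lam \<and> (i', j) \<in> diagram lam}.
        X (T (i, j)) - X (T (i', j)))"

definition specht_poly :: "nat list \<Rightarrow> (nat \<times> nat \<Rightarrow> nat) \<Rightarrow> ('k::field) mpoly" where
  "specht_poly lam T = (\<Prod>j \<in> snd ` diagram lam. column_product lam T j)"

definition specht_ideal :: "nat \<Rightarrow> nat \<Rightarrow> nat list \<Rightarrow> ('k::field) mpoly set" where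
  "specht_ideal n l lam = Idl\<^bsub>poly_ring n\<^esub> (specht_poly lam ` tableaux n l lam)"

text \<open>The sum of ideals over a (finite) set of partitions; it is \<open>{0}\<close> for the empty set.\<close>

definition specht_ideal_filter :: "nat \<Rightarrow> nat \<Rightarrow> nat list set \<Rightarrow> ('k::field) mpoly set" where
  "specht_ideal_filter n l F =
     {\<Sum>lam \<in> F. g lam | g. \<forall>lam \<in> F. g lam \<in> specht_ideal n l lam}"

section \<open>Orbit types of points and vanishing ideals\<close>

definition orbit_type :: "nat \<Rightarrow> nat \<Rightarrow> (nat \<Rightarrow> 'k) \<Rightarrow> nat list" where
  "orbit_type n l a =
     (let xs = replicate l (a 1) @ map a [2..<Suc n]
      in rev (sort (map (count_list xs) (remdups xs))))"

definition vanishing_ideal :: "nat \<Rightarrow> nat \<Rightarrow> nat list set \<Rightarrow> ('k::field) mpoly set" where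
  "vanishing_ideal n l F =
     {f \<in> carrier (poly_ring n).
        \<forall>a \<in> affine_space n. orbit_type n l a \<in> F \<longrightarrow> eval_mpoly a f = 0}"

end

theory Submission
  imports Defs "HOL-Computational_Algebra.Polynomial"
begin

text \<open>
  Write \<open>J\<close> for the vanishing ideal of the points whose orbit type lies outside a lower filter
  \<open>F\<close>. The three claims rest on one statement about leading monomials and on two
  inclusions.

  If \<open>f_T(a) \<noteq> 0\<close> for a tableau \<open>T\<close> of shape \<open>\<lambda>\<close>, then each column of \<open>T\<close> meets each value of
  \<open>a\<close> at most once; counting boxes gives that the orbit type of \<open>a\<close> is dominated by \<open>\<lambda>\<close>
  (\<open>excess_orbit_type_le\<close>). So every \<open>f_T\<close> with shape in \<open>F\<close> lies in \<open>J\<close>.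

  Conversely, every nonzero \<open>f \<in> J\<close> has a leading monomial divisible by that of \<open>f_T\<close> for a
  standard \<open>T\<close> with shape in \<open>F\<close> (\<open>standard_tableau_below_lead\<close>). The proof is by induction on
  \<open>n\<close>. Let \<open>d\<close> be the degree of \<open>f\<close> in the last, hence largest, variable, and \<open>g\<close> the
  coefficient of its \<open>d\<close>-th power. Let \<open>b\<close> be a point in one dimension less, of orbit type
  \<open>\<mu>\<close>. At least \<open>d + 1\<close> values have in \<open>b\<close> a multiplicity not below the part of
  \<open>\<mu>\<close> with index \<open>d\<close> (counted from \<open>0\<close>); extending \<open>b\<close> by such a value gives an orbit type that dominates \<open>\<mu>\<close> with a
  box added in that row. If this larger partition is outside \<open>F\<close>, the polynomial
  \<open>f(b, x)\<close> of degree at most \<open>d\<close> has \<open>d + 1\<close> zeros, so \<open>g(b) = 0\<close>. Thus \<open>g\<close> vanishes outside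
  the lower filter of those \<open>\<mu>\<close> that enter \<open>F\<close> by the added box. The standard tableau found
  for \<open>g\<close>, with the entry \<open>n\<close> put into that box, is the tableau wanted for \<open>f\<close>: the row of the
  box has index at most \<open>d\<close>, and the row indices of the entries are the exponents of the leading monomial of \<open>f_T\<close>.

  Division with remainder then puts \<open>J\<close> into the ideal of the standard Specht polynomials and
  makes these a Groebner basis. Vanishing ideals are radical. For a single \<open>\<lambda>\<close> it remains to see
  that its Specht ideal contains those of all dominated partitions
  (\<open>specht_ideal_mono\<close>): a Lagrange interpolation identity rewrites the product of two
  column differences as a combination of products in which an entry of the longer
  column has moved to the shorter one, and such moves lead from \<open>\<mu>\<close> to \<open>\<lambda>\<close>.

  Dominance enters only through the numbers \<open>\<Sum>i. max (\<mu> ! i - t) 0\<close>, one for each \<open>t\<close>. They are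
  symmetric in the parts, so that no sorting has to be followed when a part grows by one.
\<close>

section \<open>The polynomial ring and its ideals\<close>
lemma carrier_poly_ring:
  "carrier (poly_ring n) = {p. \<forall>m \<in> Poly_Mapping.keys p. Poly_Mapping.keys m \<subseteq> {1..n}}"
  by (simp add: poly_ring_def)

lemma poly_ring_ops [simp]:
  "mult (poly_ring n) = (*)" "one (poly_ring n) = 1" "zero (poly_ring n) = 0" "add (poly_ring n) = (+)"
  by (simp_all add: poly_ring_def)

lemma poly_ring_zero: "0 \<in> carrier (poly_ring n)"
  by (simp add: carrier_poly_ring)

lemma poly_ring_one: "1 \<in> carrier (poly_ring n)"
  by (simp add: carrier_poly_ring)

lemma poly_ring_add:
  "p \<in> carrier (poly_ring n) \<Longrightarrow> q \<in> carrier (poly_ring n) \<Longrightarrow> p + q \<in> carrier (poly_ring n)"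
  using keys_add[of p q] unfolding carrier_poly_ring by blast

lemma poly_ring_uminus: "p \<in> carrier (poly_ring n) \<Longrightarrow> - p \<in> carrier (poly_ring n)"
  unfolding carrier_poly_ring by (simp add: in_keys_iff)

lemma poly_ring_diff:
  "p \<in> carrier (poly_ring n) \<Longrightarrow> q \<in> carrier (poly_ring n) \<Longrightarrow> p - q \<in> carrier (poly_ring n)"
  using poly_ring_add[of p n "- q"] poly_ring_uminus[of q n] by simp

lemma poly_ring_mult:
  assumes "p \<in> carrier (poly_ring n)" "q \<in> carrier (poly_ring n)"
  shows "p * q \<in> carrier (poly_ring n)"
proof -
  have "Poly_Mapping.keys m \<subseteq> {1..n}" if m: "m \<in> Poly_Mapping.keys (p * q)" for m
  proof -
    obtain a b where "a \<in> Poly_Mapping.keys p" "b \<in> Poly_Mapping.keys q" "m = a + b"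
      using m keys_mult[of p q] by blast
    thus ?thesis
      using assms keys_add[of a b] unfolding carrier_poly_ring by blast
  qed
  thus ?thesis by (simp add: carrier_poly_ring)
qed

lemma poly_ring_prod:
  "(\<And>i. i \<in> A \<Longrightarrow> f i \<in> carrier (poly_ring n)) \<Longrightarrow> prod f A \<in> carrier (poly_ring n)"
  by (induction A rule: infinite_finite_induct) (auto intro: poly_ring_mult poly_ring_one)

lemma poly_ring_power: "p \<in> carrier (poly_ring n) \<Longrightarrow> p ^ k \<in> carrier (poly_ring n)"
  by (induction k) (auto intro: poly_ring_mult poly_ring_one)

lemma poly_ring_single: "Poly_Mapping.keys m \<subseteq> {1..n} \<Longrightarrow> Poly_Mapping.single m c \<in> carrier (poly_ring n)"
  by (simp add: carrier_poly_ring)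

lemma X_in_poly_ring: "i \<in> {1..n} \<Longrightarrow> X i \<in> carrier (poly_ring n)"
  unfolding X_def by (rule poly_ring_single) simp

lemma cring_poly_ring: "cring (poly_ring n :: 'k::field mpoly ring)"
proof (rule cringI)
  show "abelian_group (poly_ring n :: 'k mpoly ring)"
  proof (rule abelian_groupI)
    show "\<exists>y\<in>carrier (poly_ring n :: 'k mpoly ring). y \<oplus>\<^bsub>poly_ring n\<^esub> x = \<zero>\<^bsub>poly_ring n\<^esub>"
      if "x \<in> carrier (poly_ring n)" for x
      using poly_ring_uminus[OF that] by (intro bexI[of _ "- x"]) simp_all
  qed (simp_all add: poly_ring_zero poly_ring_add add.assoc add.commute)
  show "Group.comm_monoid (poly_ring n :: 'k mpoly ring)"
    by (rule comm_monoidI) (simp_all add: poly_ring_one poly_ring_mult mult.assoc mult.commute)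
qed (simp add: distrib_right)

lemma poly_ring_pow: "f [^]\<^bsub>poly_ring n\<^esub> (k::nat) = f ^ k"
proof (induction k)
  case 0
  show ?case by simp
next
  case (Suc k)
  thus ?case by (simp add: mult.commute)
qed

lemma poly_ring_a_inv:
  assumes "p \<in> carrier (poly_ring n)"
  shows "\<ominus>\<^bsub>poly_ring n\<^esub> p = - p"
proof -
  interpret cring "poly_ring n :: 'a mpoly ring" by (rule cring_poly_ring)
  show ?thesis
    using minus_equality[of "- p" p] assms poly_ring_uminus[OF assms] by simp
qed

lemma ideal_poly_ringI:
  fixes I :: "'k::field mpoly set"
  assumes sub: "I \<subseteq> carrier (poly_ring n)" and zero: "0 \<in> I"
    and add: "\<And>p q. p \<in> I \<Longrightarrow> q \<in> I \<Longrightarrow> p + q \<in> I"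
    and mult: "\<And>r p. r \<in> carrier (poly_ring n) \<Longrightarrow> p \<in> I \<Longrightarrow> r * p \<in> I"
  shows "ideal I (poly_ring n)"
proof -
  interpret cring "poly_ring n :: 'k mpoly ring" by (rule cring_poly_ring)
  have neg: "- p \<in> I" if "p \<in> I" for p
    using mult[OF poly_ring_uminus[OF poly_ring_one] that] by simp
  show ?thesis
  proof (rule idealI)
    show "ring (poly_ring n :: 'k mpoly ring)" by (rule ring_axioms)
    show "subgroup I (add_monoid (poly_ring n))"
    proof (rule add.subgroupI)
      show "I \<subseteq> carrier (poly_ring n)" by (rule sub)
      show "I \<noteq> {}" using zero by blast
      show "\<ominus>\<^bsub>poly_ring n\<^esub> a \<in> I" if "a \<in> I" for a
        using poly_ring_a_inv[of a n] sub that neg by auto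
      show "a \<oplus>\<^bsub>poly_ring n\<^esub> b \<in> I" if "a \<in> I" "b \<in> I" for a b
        using add that by simp
    qed
      show "x \<otimes>\<^bsub>poly_ring n\<^esub> a \<in> I" "a \<otimes>\<^bsub>poly_ring n\<^esub> x \<in> I"
      if "a \<in> I" "x \<in> carrier (poly_ring n)" for a x
      using mult[OF that(2,1)] by (simp_all add: mult.commute)
  qed
qed

context
  fixes I :: "'k::field mpoly set" and n :: nat
  assumes I: "ideal I (poly_ring n)"
begin

lemma ideal_sub: "I \<subseteq> carrier (poly_ring n)"
  using additive_subgroup.a_subset[OF ideal.axioms(1)[OF I]] .

lemma ideal_zero: "0 \<in> I"
  using additive_subgroup.zero_closed[OF ideal.axioms(1)[OF I]] by simp

lemma ideal_add: "p \<in> I \<Longrightarrow> q \<in> I \<Longrightarrow> p + q \<in> I"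
  using additive_subgroup.a_closed[OF ideal.axioms(1)[OF I], of p q] by simp

lemma ideal_mult: "r \<in> carrier (poly_ring n) \<Longrightarrow> p \<in> I \<Longrightarrow> r * p \<in> I"
  using ideal.I_l_closed[OF I, of p r] by simp

lemma ideal_uminus: "p \<in> I \<Longrightarrow> - p \<in> I"
  using ideal_mult[OF poly_ring_uminus[OF poly_ring_one], of p] by simp

lemma ideal_sum: "(\<And>i. i \<in> A \<Longrightarrow> f i \<in> I) \<Longrightarrow> sum f A \<in> I"
  by (induction A rule: infinite_finite_induct) (auto intro: ideal_zero ideal_add)

end

lemma genideal_poly_ring:
  fixes G :: "'k::field mpoly set"
  assumes "G \<subseteq> carrier (poly_ring n)"
  shows "ideal (Idl\<^bsub>poly_ring n\<^esub> G) (poly_ring n)" "G \<subseteq> Idl\<^bsub>poly_ring n\<^esub> G"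
    and "\<And>I. ideal I (poly_ring n) \<Longrightarrow> G \<subseteq> I \<Longrightarrow> Idl\<^bsub>poly_ring n\<^esub> G \<subseteq> I"
proof -
  interpret cring "poly_ring n :: 'k mpoly ring" by (rule cring_poly_ring)
  show "ideal (Idl\<^bsub>poly_ring n\<^esub> G) (poly_ring n)" using genideal_ideal[OF assms] .
  show "G \<subseteq> Idl\<^bsub>poly_ring n\<^esub> G" using genideal_self[OF assms] .
  show "\<And>I. ideal I (poly_ring n) \<Longrightarrow> G \<subseteq> I \<Longrightarrow> Idl\<^bsub>poly_ring n\<^esub> G \<subseteq> I"
    using genideal_minimal .
qed

section \<open>Evaluation\<close>

definition monom_eval :: "(nat \<Rightarrow> 'k) \<Rightarrow> exponent \<Rightarrow> 'k::field" where
  "monom_eval a m = (\<Prod>i \<in> Poly_Mapping.keys m. a i ^ Poly_Mapping.lookup m i)"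

lemma monom_eval_superset:
  assumes "finite S" "Poly_Mapping.keys m \<subseteq> S"
  shows "monom_eval a m = (\<Prod>i \<in> S. a i ^ Poly_Mapping.lookup m i)"
  unfolding monom_eval_def
  by (rule prod.mono_neutral_left) (use assms in \<open>auto simp: in_keys_iff\<close>)

lemma monom_eval_add: "monom_eval a (m + m') = monom_eval a m * monom_eval a m'"
proof -
  let ?S = "Poly_Mapping.keys m \<union> Poly_Mapping.keys m'"
  show ?thesis
    using keys_add[of m m']
    by (simp add: monom_eval_superset[of ?S] lookup_add power_add prod.distrib)
qed

lemma eval_superset:
  assumes "finite S" "Poly_Mapping.keys p \<subseteq> S"
  shows "eval_mpoly a p = (\<Sum>m \<in> S. Poly_Mapping.lookup p m * monom_eval a m)"
  unfolding eval_mpoly_def monom_eval_def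
  by (rule sum.mono_neutral_left) (use assms in \<open>auto simp: in_keys_iff\<close>)

lemma eval_zero [simp]: "eval_mpoly a 0 = 0"
  by (simp add: eval_mpoly_def)

lemma eval_add [simp]: "eval_mpoly a (p + q) = eval_mpoly a p + eval_mpoly a q"
proof -
  let ?S = "Poly_Mapping.keys p \<union> Poly_Mapping.keys q"
  show ?thesis
    using keys_add[of p q]
    by (simp add: eval_superset[of ?S] lookup_add distrib_right sum.distrib)
qed

lemma eval_uminus [simp]: "eval_mpoly a (- p) = - eval_mpoly a p"
  using eval_add[of a p "- p"] by (simp add: eq_neg_iff_add_eq_0 add.commute)

lemma eval_diff [simp]: "eval_mpoly a (p - q) = eval_mpoly a p - eval_mpoly a q"
  using eval_add[of a p "- q"] by simp

lemma eval_sum [simp]: "eval_mpoly a (sum f A) = (\<Sum>i\<in>A. eval_mpoly a (f i))"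
  by (induction A rule: infinite_finite_induct) auto

lemma eval_single [simp]: "eval_mpoly a (Poly_Mapping.single m c) = c * monom_eval a m"
  by (cases "c = 0") (simp_all add: eval_mpoly_def monom_eval_def)

lemma sum_single_lookup: "(\<Sum>m \<in> Poly_Mapping.keys p. Poly_Mapping.single m (Poly_Mapping.lookup p m)) = p"
proof (rule poly_mapping_eqI)
  fix k
  have "(\<Sum>m \<in> Poly_Mapping.keys p. Poly_Mapping.lookup (Poly_Mapping.single m (Poly_Mapping.lookup p m)) k)
      = (\<Sum>m \<in> Poly_Mapping.keys p. if m = k then Poly_Mapping.lookup p m else 0)"
    by (rule sum.cong) (auto simp: lookup_single when_def)
  thus "Poly_Mapping.lookup (\<Sum>m \<in> Poly_Mapping.keys p. Poly_Mapping.single m (Poly_Mapping.lookup p m)) k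
      = Poly_Mapping.lookup p k"
    by (simp add: lookup_sum in_keys_iff)
qed

lemma eval_mult [simp]: "eval_mpoly a (p * q) = eval_mpoly a p * eval_mpoly a q"
proof -
  let ?P = "Poly_Mapping.keys p" and ?Q = "Poly_Mapping.keys q"
  have "p * q = (\<Sum>m \<in> ?P. Poly_Mapping.single m (Poly_Mapping.lookup p m)) *
      (\<Sum>m \<in> ?Q. Poly_Mapping.single m (Poly_Mapping.lookup q m))"
    by (simp only: sum_single_lookup)
  also have "\<dots> = (\<Sum>m \<in> ?P. \<Sum>m' \<in> ?Q.
      Poly_Mapping.single (m + m') (Poly_Mapping.lookup p m * Poly_Mapping.lookup q m'))"
    by (simp add: sum_product mult_single)
  finally have "eval_mpoly a (p * q) = (\<Sum>m \<in> ?P. \<Sum>m' \<in> ?Q.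
      Poly_Mapping.lookup p m * Poly_Mapping.lookup q m' * (monom_eval a m * monom_eval a m'))"
    by (simp add: monom_eval_add)
  also have "\<dots> = eval_mpoly a p * eval_mpoly a q"
    by (simp add: eval_superset[of ?P] eval_superset[of ?Q] sum_product algebra_simps)
  finally show ?thesis .
qed

lemma eval_one [simp]: "eval_mpoly a 1 = 1"
  using eval_single[of a 0 1] by (simp add: monom_eval_def)

lemma eval_prod [simp]: "eval_mpoly a (prod f A) = (\<Prod>i\<in>A. eval_mpoly a (f i))"
  by (induction A rule: infinite_finite_induct) auto

lemma eval_power [simp]: "eval_mpoly a (p ^ k) = eval_mpoly a p ^ k"
  by (induction k) auto

lemma eval_X [simp]: "eval_mpoly a (X i) = a i"
  by (simp add: X_def monom_eval_def)

lemma eval_cong: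
  assumes "p \<in> carrier (poly_ring n)" "\<And>i. i \<in> {1..n} \<Longrightarrow> a i = b i"
  shows "eval_mpoly a p = eval_mpoly b p"
  unfolding eval_mpoly_def
  using assms by (intro sum.cong prod.cong arg_cong2[of _ _ _ _ "(*)"]) (auto simp: carrier_poly_ring subset_iff)

lemma radical_vanishing_ideal:
  "radical_ideal (vanishing_ideal n l F :: 'k::field mpoly set) (poly_ring n)"
  unfolding radical_ideal_def
proof (intro conjI ballI allI impI)
  show "ideal (vanishing_ideal n l F :: 'k mpoly set) (poly_ring n)"
    by (rule ideal_poly_ringI) (auto simp: vanishing_ideal_def poly_ring_zero poly_ring_add poly_ring_mult)
  fix f :: "'k mpoly" and k :: nat
  assume "f \<in> carrier (poly_ring n)" "f [^]\<^bsub>poly_ring n\<^esub> k \<in> vanishing_ideal n l F"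
  thus "f \<in> vanishing_ideal n l F"
    by (simp add: vanishing_ideal_def poly_ring_pow)
qed

section \<open>Leading exponents in the lexicographic order\<close>

lemma lex_less_irrefl: "\<not> lex_less u u"
  by (simp add: lex_less_def)

lemma lex_less_trans: 
  assumes "lex_less u v" "lex_less v w" shows "lex_less u w"
proof -
  obtain i j where i: "Poly_Mapping.lookup u i < Poly_Mapping.lookup v i" "\<forall>k > i. Poly_Mapping.lookup u k = Poly_Mapping.lookup v k"
    and j: "Poly_Mapping.lookup v j < Poly_Mapping.lookup w j" "\<forall>k > j. Poly_Mapping.lookup v k = Poly_Mapping.lookup w k"
    using assms unfolding lex_less_def by blast
  have "Poly_Mapping.lookup u (max i j) < Poly_Mapping.lookup w (max i j)"
    using i j by (cases i j rule: linorder_cases) auto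
  moreover have "\<forall>k > max i j. Poly_Mapping.lookup u k = Poly_Mapping.lookup w k"
    using i j by simp
  ultimately show ?thesis unfolding lex_less_def by blast
qed

lemma lex_less_linear:
  assumes "u \<noteq> v" shows "lex_less u v \<or> lex_less v u"
proof -
  let ?D = "{i. Poly_Mapping.lookup u i \<noteq> Poly_Mapping.lookup v i}"
  have "?D \<subseteq> Poly_Mapping.keys u \<union> Poly_Mapping.keys v" by (auto simp: in_keys_iff)
  hence fin: "finite ?D" by (rule finite_subset) simp
  have ne: "?D \<noteq> {}" using assms poly_mapping_eqI[of u v] by blast
  obtain M where M: "M = Max ?D" by simp
  have "M \<in> ?D" unfolding M by (rule Max_in[OF fin ne])
  hence neq: "Poly_Mapping.lookup u M \<noteq> Poly_Mapping.lookup v M" by simp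
  have above: "Poly_Mapping.lookup u j = Poly_Mapping.lookup v j" if "j > M" for j
  proof (rule ccontr)
    assume "Poly_Mapping.lookup u j \<noteq> Poly_Mapping.lookup v j"
    hence "j \<le> M" unfolding M by (intro Max_ge[OF fin]) simp
    thus False using that by simp
  qed
  show ?thesis
  proof (cases "Poly_Mapping.lookup u M < Poly_Mapping.lookup v M")
    case True
    thus ?thesis using above unfolding lex_less_def by blast
  next
    case False
    hence "Poly_Mapping.lookup v M < Poly_Mapping.lookup u M" using neq by simp
    moreover have "\<forall>j > M. Poly_Mapping.lookup v j = Poly_Mapping.lookup u j" using above by simp
    ultimately show ?thesis unfolding lex_less_def by blast
  qed
qed

lemma lex_less_add_right: "lex_less u v \<Longrightarrow> lex_less (u + w) (v + w)"
  by (auto simp: lex_less_def lookup_add)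

definition is_lead :: "('k::field) mpoly \<Rightarrow> exponent \<Rightarrow> bool" where
  "is_lead p m \<longleftrightarrow> m \<in> Poly_Mapping.keys p \<and> (\<forall>m' \<in> Poly_Mapping.keys p. m' \<noteq> m \<longrightarrow> lex_less m' m)"

lemma is_lead_unique: "is_lead p m \<Longrightarrow> is_lead p m' \<Longrightarrow> m = m'"
proof (rule ccontr)
  assume "is_lead p m" "is_lead p m'" "m \<noteq> m'"
  hence "lex_less m m'" "lex_less m' m" unfolding is_lead_def by simp_all
  thus False using lex_less_trans[of m m' m] lex_less_irrefl[of m] by simp
qed

lemma initial_monomial_eq: "is_lead p m \<Longrightarrow> initial_monomial p = Poly_Mapping.single m 1"
  unfolding initial_monomial_def is_lead_def[symmetric]
  by (rule arg_cong[where f = "\<lambda>m. Poly_Mapping.single m 1"], rule the_equality)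
    (auto intro: is_lead_unique)

lemma is_lead_exists:
  assumes "p \<noteq> 0" shows "\<exists>m. is_lead p m"
proof -
  have "\<exists>m\<in>A. \<forall>m'\<in>A. m' \<noteq> m \<longrightarrow> lex_less m' m" if "finite A" "A \<noteq> {}" for A
    using that
  proof (induction A rule: finite_ne_induct)
    case (insert x A)
    then obtain m where m: "m \<in> A" "\<forall>m'\<in>A. m' \<noteq> m \<longrightarrow> lex_less m' m" by blast
    show ?case
    proof (cases "lex_less x m")
      case True
      thus ?thesis using m by blast
    next
      case False
      have "x \<noteq> m" using m(1) insert.hyps by blast
      hence "lex_less m x" using lex_less_linear[of x m] False by simp
      hence "\<forall>m'\<in>insert x A. m' \<noteq> x \<longrightarrow> lex_less m' x"
        using m(2) lex_less_trans by (metis insert_iff)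
      thus ?thesis by blast
    qed
  qed simp
  from this[of "Poly_Mapping.keys p"] assms show ?thesis
    unfolding is_lead_def by auto
qed

text \<open>
  Splitting off the leading term turns products and cancellations of leading terms into ring
  computations.
\<close>

lemma is_lead_iff:
  "is_lead p m \<longleftrightarrow> (\<exists>c q. c \<noteq> 0 \<and> p = Poly_Mapping.single m c + q \<and> (\<forall>k \<in> Poly_Mapping.keys q. lex_less k m))"
proof
  assume L: "is_lead p m"
  let ?c = "Poly_Mapping.lookup p m"
  let ?q = "p - Poly_Mapping.single m ?c"
  have look: "Poly_Mapping.lookup ?q k = (if k = m then 0 else Poly_Mapping.lookup p k)" for k
    by (simp add: lookup_minus lookup_single when_def)
  have "lex_less k m" if "k \<in> Poly_Mapping.keys ?q" for k
  proof -
    have "k \<noteq> m" "k \<in> Poly_Mapping.keys p"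
      using that unfolding in_keys_iff look by (simp_all split: if_splits)
    thus ?thesis using L by (simp add: is_lead_def)
  qed
  moreover have "?c \<noteq> 0" using L by (simp add: is_lead_def in_keys_iff)
  ultimately have "?c \<noteq> 0 \<and> p = Poly_Mapping.single m ?c + ?q \<and> (\<forall>k \<in> Poly_Mapping.keys ?q. lex_less k m)"
    by (metis add_diff_cancel_left' add.commute diff_add_cancel)
  thus "\<exists>c q. c \<noteq> 0 \<and> p = Poly_Mapping.single m c + q \<and> (\<forall>k \<in> Poly_Mapping.keys q. lex_less k m)"
    by metis
next
  assume "\<exists>c q. c \<noteq> 0 \<and> p = Poly_Mapping.single m c + q \<and> (\<forall>k \<in> Poly_Mapping.keys q. lex_less k m)"
  then obtain c q where c: "c \<noteq> 0" "p = Poly_Mapping.single m c + q"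
    and q: "\<forall>k \<in> Poly_Mapping.keys q. lex_less k m" by blast
  have "m \<notin> Poly_Mapping.keys q" using q lex_less_irrefl by blast
  hence "Poly_Mapping.lookup q m = 0" by (simp only: in_keys_iff) simp
  hence "m \<in> Poly_Mapping.keys p" unfolding in_keys_iff c(2) lookup_add using c(1) by simp
  moreover have "lex_less k m" if "k \<in> Poly_Mapping.keys p" "k \<noteq> m" for k
  proof -
    have "k \<in> Poly_Mapping.keys q"
      using that unfolding in_keys_iff c(2) lookup_add by (simp add: lookup_single_not_eq)
    thus ?thesis using q by blast
  qed
  ultimately show "is_lead p m" unfolding is_lead_def by blast
qed

lemma is_lead_mult:
  assumes "is_lead p m" "is_lead q m'"
  shows "is_lead (p * q) (m + m')"
proof -
  obtain c p' where c: "c \<noteq> 0" "p = Poly_Mapping.single m c + p'" "\<forall>k \<in> Poly_Mapping.keys p'. lex_less k m"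
    using assms(1) is_lead_iff by blast
  obtain d q' where d: "d \<noteq> 0" "q = Poly_Mapping.single m' d + q'" "\<forall>k \<in> Poly_Mapping.keys q'. lex_less k m'"
    using assms(2) is_lead_iff by blast
  let ?r = "Poly_Mapping.single m c * q' + p' * q"
  have "p * q = Poly_Mapping.single (m + m') (c * d) + ?r"
    using c(2) d(2) by (simp add: algebra_simps mult_single)
  moreover have "lex_less k (m + m')" if "k \<in> Poly_Mapping.keys ?r" for k
  proof -
    from that consider "k \<in> Poly_Mapping.keys (Poly_Mapping.single m c * q')" | "k \<in> Poly_Mapping.keys (p' * q)"
      using keys_add[of "Poly_Mapping.single m c * q'" "p' * q"] by blast
    thus ?thesis
    proof cases
      case 1
      then obtain k' where "k' \<in> Poly_Mapping.keys q'" "k = m + k'"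
        using keys_mult[of "Poly_Mapping.single m c" q'] c(1) by auto
      thus ?thesis using d(3) lex_less_add_right[of k' m' m] by (simp add: add.commute)
    next
      case 2
      then obtain k1 k2 where k: "k1 \<in> Poly_Mapping.keys p'" "k2 \<in> Poly_Mapping.keys q" "k = k1 + k2"
        using keys_mult[of p' q] by blast
      have "lex_less (k1 + k2) (m + k2)" using k(1) c(3) lex_less_add_right by blast
      moreover have "k2 = m' \<or> lex_less (m + k2) (m + m')"
        using k(2) assms(2) lex_less_add_right[of k2 m' m] by (auto simp: is_lead_def add.commute)
      ultimately show ?thesis using k(3) lex_less_trans by blast
    qed
  qed
  ultimately show ?thesis
    using c(1) d(1) unfolding is_lead_iff by (metis mult_eq_0_iff)
qed

lemma is_lead_single: "c \<noteq> 0 \<Longrightarrow> is_lead (Poly_Mapping.single m c) m"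
  by (simp add: is_lead_def)

lemma is_lead_one: "is_lead 1 0"
  using is_lead_single[of 1 0] by simp

lemma is_lead_prod:
  "finite A \<Longrightarrow> (\<And>i. i \<in> A \<Longrightarrow> is_lead (f i) (m i)) \<Longrightarrow> is_lead (prod f A) (sum m A)"
  by (induction A rule: finite_induct) (auto intro: is_lead_mult is_lead_one)

lemma is_lead_X_diff:
  assumes "a < b" shows "is_lead (X a - X b :: 'k::field mpoly) (Poly_Mapping.single b 1)"
proof -
  have "lex_less (Poly_Mapping.single a 1) (Poly_Mapping.single b 1)"
    unfolding lex_less_def using assms by (intro exI[of _ b]) (auto simp: lookup_single when_def)
  moreover have "X a - X b = Poly_Mapping.single (Poly_Mapping.single b 1) (- 1) + (X a :: 'k mpoly)"
    by (simp add: X_def single_uminus)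
  moreover have "Poly_Mapping.keys (X a :: 'k mpoly) = {Poly_Mapping.single a 1}"
    by (simp add: X_def)
  ultimately show ?thesis unfolding is_lead_iff
    by (intro exI[of _ "- 1"] exI[of _ "X a"]) auto
qed

text \<open>
  With a fixed finite set of variables the order is the lexicographic order on lists of the
  exponents, read from the largest variable downwards.
\<close>

lemma wf_lex_less: "wf {(u, v). lex_less u v \<and> Poly_Mapping.keys u \<subseteq> {1..n} \<and> Poly_Mapping.keys v \<subseteq> {1..n}}"
proof (rule wf_subset)
  let ?g = "\<lambda>u::exponent. map (\<lambda>i. Poly_Mapping.lookup u (n - i)) [0..<n]"
  show "wf (inv_image (lexn less_than n) ?g)" by (intro wf_inv_image wf_lexn wf_less_than)
  show "{(u, v). lex_less u v \<and> Poly_Mapping.keys u \<subseteq> {1..n} \<and> Poly_Mapping.keys v \<subseteq> {1..n}} \<subseteq> inv_image (lexn less_than n) ?g"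
  proof clarify
    fix u v assume uv: "lex_less u v" "Poly_Mapping.keys u \<subseteq> {1..n}" "Poly_Mapping.keys v \<subseteq> {1..n}"
    then obtain i where i: "Poly_Mapping.lookup u i < Poly_Mapping.lookup v i" "\<forall>j > i. Poly_Mapping.lookup u j = Poly_Mapping.lookup v j"
      unfolding lex_less_def by blast
    hence "i \<in> Poly_Mapping.keys v" by (auto simp: in_keys_iff)
    hence i1: "i \<in> {1..n}" using uv by blast
    have "[0..<n] = [0..<n - i] @ [n - i..<n]" using upt_add_eq_append[of 0 "n - i" i] i1 by simp
    moreover have "[n - i..<n] = (n - i) # [Suc (n - i)..<n]" using i1 by (simp add: upt_conv_Cons)
    ultimately have split: "[0..<n] = [0..<n - i] @ (n - i) # [Suc (n - i)..<n]" by simp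
    have pre: "map (\<lambda>i. Poly_Mapping.lookup u (n - i)) [0..<n-i] = map (\<lambda>i. Poly_Mapping.lookup v (n - i)) [0..<n-i]"
      using i i1 by auto
    have ii: "n - (n - i) = i" using i1 by simp
    have "?g u = map (\<lambda>i. Poly_Mapping.lookup u (n - i)) [0..<n-i] @ Poly_Mapping.lookup u i #
          map (\<lambda>i. Poly_Mapping.lookup u (n - i)) [Suc (n - i)..<n]"
      "?g v = map (\<lambda>i. Poly_Mapping.lookup u (n - i)) [0..<n-i] @ Poly_Mapping.lookup v i #
          map (\<lambda>i. Poly_Mapping.lookup v (n - i)) [Suc (n - i)..<n]"
      unfolding split map_append list.map by (simp_all only: pre ii)
    moreover have "length (?g u) = n" "length (?g v) = n" by simp_all
    moreover have "(Poly_Mapping.lookup u i, Poly_Mapping.lookup v i) \<in> less_than" using i(1) by simp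
    ultimately have "(?g u, ?g v) \<in> lexn less_than n"
      unfolding lexn_conv mem_Collect_eq prod.case by blast
    thus "(u, v) \<in> inv_image (lexn less_than n) ?g" by simp
  qed
qed

section \<open>Dominance through excesses\<close>
text \<open>
  The number of boxes of the diagram in the columns with index at least \<open>t\<close>; as \<open>t\<close> varies, these
  are the tail sums of the conjugate partition.
\<close>

definition excess :: "nat \<Rightarrow> nat list \<Rightarrow> nat" where
  "excess t xs = (\<Sum>x\<leftarrow>xs. x - t)"

lemma excess_Nil [simp]: "excess t [] = 0"
  and excess_Cons [simp]: "excess t (x # xs) = (x - t) + excess t xs"
  by (simp_all add: excess_def)

lemma excess_0 [simp]: "excess 0 xs = sum_list xs"
  by (simp add: excess_def)

lemma sum_take_le_excess: "sum_list (take k xs) \<le> excess t xs + k * t"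
proof (induction xs arbitrary: k)
  case (Cons x xs)
  show ?case
  proof (cases k)
    case (Suc j)
    show ?thesis using Cons.IH[of j] Suc by simp
  qed simp
qed simp

lemma excess_eq_0: "(\<And>x. x \<in> set xs \<Longrightarrow> x \<le> t) \<Longrightarrow> excess t xs = 0"
  by (induction xs) simp_all

lemma excess_eq_sum_take:
  assumes "sorted_wrt (\<ge>) xs"
  shows "\<exists>k. excess t xs + k * t = sum_list (take k xs)"
  using assms
proof (induction xs)
  case (Cons x xs)
  show ?case
  proof (cases "x \<le> t")
    case True
    hence "excess t (x # xs) = 0" using Cons.prems by (intro excess_eq_0) auto
    thus ?thesis by (intro exI[of _ 0]) simp
  next
    case False
    obtain k where "excess t xs + k * t = sum_list (take k xs)" using Cons by auto
    thus ?thesis using False by (intro exI[of _ "Suc k"]) simp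
  qed
qed simp

text \<open>
  Parts with index beyond the length are \<open>0\<close>, so that opening a new row is adding a box to a row
  of length \<open>0\<close>.
\<close>

definition part :: "nat list \<Rightarrow> nat \<Rightarrow> nat" where
  "part xs i = (if i < length xs then xs ! i else 0)"

lemma sum_take_eq_excess:
  assumes "sorted_wrt (\<ge>) xs"
  shows "sum_list (take k xs) = excess (part xs k) xs + k * part xs k"
  using assms
proof (induction xs arbitrary: k)
  case (Cons x xs)
  show ?case
  proof (cases k)
    case 0
    have "excess x (x # xs) = 0" using Cons.prems by (intro excess_eq_0) auto
    thus ?thesis using 0 by (simp add: part_def)
  next
    case (Suc j)
    have "part (x # xs) k = part xs j" using Suc by (simp add: part_def)
    moreover have "part xs j \<le> x" using Cons.prems by (auto simp: part_def)
    ultimately show ?thesis using Cons.IH[of j] Cons.prems Suc by simp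
  qed
qed (simp add: part_def)

lemma sum_take_mono: "i \<le> j \<Longrightarrow> sum_list (take i xs) \<le> sum_list (take j (xs :: nat list))"
  by (metis le_add1 le_iff_add sum_list.append take_add)

lemma sum_take_le_sum: "sum_list (take i xs) \<le> sum_list (xs :: nat list)"
  by (metis append_take_drop_id le_add1 sum_list_append)

text \<open>
  The first \<open>k\<close> parts sum to at most \<open>excess t xs + k * t\<close> for every \<open>t\<close>. For each \<open>t\<close> some
  \<open>k\<close> gives equality, and for each \<open>k\<close> so does the part with index \<open>k\<close> as \<open>t\<close>. Hence partial
  sums and excesses determine each other monotonically.
\<close>

lemma dominated_iff_excess:
  assumes mu: "mu \<in> partitions m" and lam: "lam \<in> partitions m"
  shows "dominated mu lam \<longleftrightarrow> (\<forall>t. excess t mu \<le> excess t lam)"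
proof
  assume dom: "dominated mu lam"
  have sums: "sum_list mu = m" "sum_list lam = m" using mu lam by (auto simp: partitions_def)
  have all: "sum_list (take i mu) \<le> sum_list (take i lam)" for i
  proof (cases "length lam \<le> i")
    case True
    thus ?thesis using sum_take_le_sum[of i mu] sums by simp
  next
    case False
    show ?thesis
    proof (cases "i \<le> length mu")
      case True
      thus ?thesis using dom False by (cases i) (simp_all add: dominated_def)
    next
      case 2: False
      have "sum_list (take (length mu) mu) \<le> sum_list (take (length mu) lam)"
      proof (cases "mu = []")
        case mu: False
        have "1 \<le> length mu" "length mu \<le> length lam" using mu False 2 by (cases mu; simp)+
        thus ?thesis using dom[unfolded dominated_def, rule_format, of "length mu"] by simp
      qed simp
      also have "\<dots> \<le> sum_list (take i lam)" using 2 by (intro sum_take_mono) simp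
      finally show ?thesis using 2 by simp
    qed
  qed
  show "\<forall>t. excess t mu \<le> excess t lam"
  proof
    fix t
    obtain k where k: "excess t mu + k * t = sum_list (take k mu)"
      using excess_eq_sum_take[of mu t] mu by (auto simp: partitions_def)
    thus "excess t mu \<le> excess t lam"
      using all[of k] sum_take_le_excess[of k lam t] by linarith
  qed
next
  assume ex: "\<forall>t. excess t mu \<le> excess t lam"
  have "sum_list (take i mu) \<le> sum_list (take i lam)" for i
  proof -
    have "sum_list (take i mu) \<le> excess (part lam i) mu + i * part lam i"
      by (rule sum_take_le_excess)
    also have "\<dots> \<le> excess (part lam i) lam + i * part lam i" using ex by simp
    also have "\<dots> = sum_list (take i lam)"
      using sum_take_eq_excess[of lam i] lam by (simp add: partitions_def)
    finally show ?thesis .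
  qed
  thus "dominated mu lam" by (simp add: dominated_def)
qed

lemma excess_eq_sum_part:
  assumes "length xs \<le> N" shows "excess t xs = (\<Sum>i<N. part xs i - t)"
proof -
  have "excess t xs = (\<Sum>i<length xs. part xs i - t)"
    by (simp add: excess_def sum_list_sum_nth atLeast0LessThan part_def)
  also have "\<dots> = (\<Sum>i<N. part xs i - t)"
    using assms by (intro sum.mono_neutral_left) (auto simp: part_def)
  finally show ?thesis .
qed

lemma partition_part_antimono:
  assumes "mu \<in> partitions m" "i \<le> j" shows "part mu j \<le> part mu i"
proof -
  have "sorted_wrt (\<ge>) mu" using assms by (simp add: partitions_def)
  thus ?thesis using assms(2)
    by (cases "i = j") (auto simp: part_def sorted_wrt_iff_nth_less)
qed

lemma partition_part_pos: "mu \<in> partitions m \<Longrightarrow> 0 < part mu i \<longleftrightarrow> i < length mu"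
  by (auto simp: part_def partitions_def)

lemma diagram_iff: "(i, j) \<in> diagram mu \<longleftrightarrow> j < part mu i"
  by (auto simp: diagram_def part_def)

lemma finite_diagram [simp]: "finite (diagram mu)"
proof -
  have "diagram mu = (SIGMA i:{..<length mu}. {..<mu ! i})" by (auto simp: diagram_def)
  thus ?thesis by simp
qed

lemma partitionsI:
  assumes "\<And>i j. i \<le> j \<Longrightarrow> part mu j \<le> part mu i" "\<And>i. i < length mu \<Longrightarrow> 0 < part mu i" "sum_list mu = m"
  shows "mu \<in> partitions m"
  unfolding partitions_def sorted_wrt_iff_nth_less
proof (clarify, intro conjI allI impI ballI)
  fix i j assume "i < j" "j < length mu"
  thus "mu ! j \<le> mu ! i" using assms(1)[of i j] by (simp add: part_def)
next
  fix x assume "x \<in> set mu"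
  then obtain i where "i < length mu" "x = mu ! i" by (auto simp: in_set_conv_nth)
  thus "0 < x" using assms(2)[of i] by (simp add: part_def)
qed (rule assms(3))

section \<open>Adding a box to a partition\<close>

text \<open>
  To stay a partition, the topmost row of the same length as row \<open>d\<close> receives the box.
\<close>

definition box_row :: "nat \<Rightarrow> nat list \<Rightarrow> nat" where
  "box_row d mu = (LEAST i. part mu i = part mu d)"

definition add_box :: "nat \<Rightarrow> nat list \<Rightarrow> nat list" where
  "add_box d mu = (let p = box_row d mu in
     if p < length mu then mu[p := Suc (mu ! p)] else mu @ [1])"

lemma box_row_le: "box_row d mu \<le> d"
  unfolding box_row_def by (rule Least_le) simp

lemma part_box_row: "part mu (box_row d mu) = part mu d"
  unfolding box_row_def by (rule LeastI) simp

lemma part_above_box_row: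
  assumes "mu \<in> partitions m" "i < box_row d mu" shows "part mu d < part mu i"
proof -
  have "part mu i \<noteq> part mu d" using assms(2) unfolding box_row_def by (rule not_less_Least)
  moreover have "part mu (box_row d mu) \<le> part mu i"
    using assms by (intro partition_part_antimono) simp_all
  ultimately show ?thesis by (simp add: part_box_row)
qed

lemma box_row_le_length: "mu \<in> partitions m \<Longrightarrow> box_row d mu \<le> length mu"
proof (cases "d < length mu")
  case True
  thus ?thesis using box_row_le[of d mu] by simp
next
  case False
  hence "part mu (length mu) = part mu d" by (simp add: part_def)
  thus ?thesis unfolding box_row_def by (rule Least_le)
qed

lemma part_add_box:
  assumes "mu \<in> partitions m"
  shows "part (add_box d mu) = (part mu)(box_row d mu := Suc (part mu d))"
proof
  fix i
  have "box_row d mu \<le> length mu" by (rule box_row_le_length[OF assms])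
  moreover have "part mu (box_row d mu) = part mu d" by (rule part_box_row)
  ultimately show "part (add_box d mu) i = ((part mu)(box_row d mu := Suc (part mu d))) i"
    unfolding add_box_def Let_def part_def by (auto simp: nth_append split: if_splits)
qed

lemma excess_add_box:
  assumes "mu \<in> partitions m"
  shows "excess t (add_box d mu) = excess t mu + (if t \<le> part mu d then 1 else 0)"
proof -
  let ?N = "Suc (length mu)" and ?p = "box_row d mu"
  have p: "?p \<in> {..<?N}" using box_row_le_length[OF assms, of d] by simp
  have "excess t (add_box d mu) = (\<Sum>i<?N. part (add_box d mu) i - t)"
    by (rule excess_eq_sum_part) (simp add: add_box_def Let_def)
  also have "\<dots> = (Suc (part mu d) - t) + (\<Sum>i\<in>{..<?N} - {?p}. part mu i - t)"
    unfolding sum.remove[OF finite_lessThan p] part_add_box[OF assms] by simp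
  also have "\<dots> = (part mu d - t) + (\<Sum>i\<in>{..<?N} - {?p}. part mu i - t) + (if t \<le> part mu d then 1 else 0)"
    by auto
  also have "(part mu d - t) + (\<Sum>i\<in>{..<?N} - {?p}. part mu i - t) = (\<Sum>i<?N. part mu i - t)"
    unfolding sum.remove[OF finite_lessThan p] by (simp add: part_box_row)
  also have "\<dots> = excess t mu" by (rule excess_eq_sum_part[symmetric]) simp
  finally show ?thesis .
qed

lemma partitions_ge_iff:
  assumes "1 \<le> n" "1 \<le> l"
  shows "mu \<in> partitions_ge n l \<longleftrightarrow> mu \<in> partitions (n + l - 1) \<and> l \<le> part mu 0"
proof (cases mu)
  case Nil
  thus ?thesis using assms by (simp add: partitions_ge_def partitions_def)
qed (simp add: partitions_ge_def part_def)

lemma add_box_partitions_ge: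
  assumes "1 \<le> n" "1 \<le> l" "mu \<in> partitions_ge n l"
  shows "add_box d mu \<in> partitions_ge (Suc n) l"
proof -
  have mu: "mu \<in> partitions (n + l - 1)" "l \<le> part mu 0"
    using assms by (auto simp: partitions_ge_iff)
  let ?p = "box_row d mu"
  note part = part_add_box[OF mu(1), of d]
  have "add_box d mu \<in> partitions (Suc n + l - 1)"
  proof (rule partitionsI)
    fix i j :: nat assume "i \<le> j"
    thus "part (add_box d mu) j \<le> part (add_box d mu) i"
      using partition_part_antimono[OF mu(1), of i j] part_above_box_row[OF mu(1), of i d]
        part_box_row[of mu d] unfolding part by auto
  next
    fix i assume "i < length (add_box d mu)"
    thus "0 < part (add_box d mu) i"
      using partition_part_pos[OF mu(1), of i] box_row_le_length[OF mu(1), of d]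
      unfolding part by (auto simp: add_box_def Let_def split: if_splits)
  next
    show "sum_list (add_box d mu) = Suc n + l - 1"
      using excess_add_box[OF mu(1), of 0 d] mu(1) assms(1) by (simp add: partitions_def)
  qed
  moreover have "part mu 0 \<le> part (add_box d mu) 0" 
    unfolding part using part_box_row[of mu d] by auto
  ultimately show ?thesis using mu(2) assms by (auto simp: partitions_ge_iff)
qed

lemma diagram_add_box:
  assumes "mu \<in> partitions m"
  shows "diagram (add_box d mu) = insert (box_row d mu, part mu d) (diagram mu)"
    and "(box_row d mu, part mu d) \<notin> diagram mu"
  by (auto simp: diagram_iff part_add_box[OF assms] part_box_row less_Suc_eq split: if_splits)

text \<open>
  The discrete derivative of the excess counts the large parts; this is how the excesses see the
  individual rows.
\<close>

lemma excess_Suc: "excess t mu = excess (Suc t) mu + length (filter (\<lambda>x. Suc t \<le> x) mu)"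
  by (induction mu) auto

lemma length_filter_part:
  assumes "mu \<in> partitions m" "0 < t"
  shows "d < length (filter (\<lambda>x. t \<le> x) mu) \<longleftrightarrow> t \<le> part mu d"
proof -
  have "sorted_wrt (\<ge>) mu" using assms by (simp add: partitions_def)
  thus ?thesis
  proof (induction mu arbitrary: d)
    case Nil
    thus ?case using assms(2) by (simp add: part_def)
  next
    case (Cons x mu)
    show ?case
    proof (cases "t \<le> x")
      case True
      show ?thesis
      proof (cases d)
        case (Suc e)
        thus ?thesis using Cons.IH[of e] Cons.prems True by (simp add: part_def)
      qed (use True in \<open>simp add: part_def\<close>)
    next
      case False
      hence "filter (\<lambda>x. t \<le> x) mu = []" using Cons.prems by (auto simp: filter_empty_conv)
      moreover have "part (x # mu) d \<le> x" using Cons.prems by (cases d) (auto simp: part_def)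
      ultimately show ?thesis using False by simp
    qed
  qed
qed

text \<open>
  Where the excesses of \<open>nu\<close> and \<open>mu\<close> agree at \<open>t\<close> while only \<open>nu\<close> gains a box in column \<open>t\<close>
  or further right, \<open>nu\<close> has more parts of size at least \<open>t\<close> than \<open>mu\<close>; one step down, at \<open>t - 1\<close>, its
  excess would be the larger one.
\<close>

lemma add_box_mono:
  assumes "mu \<in> partitions m" "nu \<in> partitions m" "\<forall>t. excess t nu \<le> excess t mu"
  shows "excess t (add_box d nu) \<le> excess t (add_box d mu)"
proof (rule ccontr)
  assume "\<not> ?thesis"
  hence eq: "excess t nu = excess t mu" and t: "t \<le> part nu d" "\<not> t \<le> part mu d"
    using assms(3)[rule_format, of t]
    by (auto simp: excess_add_box[OF assms(1)] excess_add_box[OF assms(2)] split: if_splits)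
  then obtain s where s: "t = Suc s" by (cases t) auto
  have "d < length (filter (\<lambda>x. t \<le> x) nu)" "\<not> d < length (filter (\<lambda>x. t \<le> x) mu)"
    using t length_filter_part[OF assms(1), of t d] length_filter_part[OF assms(2), of t d] s by simp_all
  hence "excess s mu < excess s nu" using eq excess_Suc[of s mu] excess_Suc[of s nu] s by simp
  thus False using assms(3) by (simp add: leD)
qed

section \<open>Orbit types of points\<close>

definition shape_of :: "'a list \<Rightarrow> nat list" where
  "shape_of xs = rev (sort (map (count_list xs) (remdups xs)))"

definition point_list :: "nat \<Rightarrow> nat \<Rightarrow> (nat \<Rightarrow> 'k) \<Rightarrow> 'k list" where
  "point_list n l a = replicate l (a 1) @ map a [2..<Suc n]"

lemma orbit_type_eq: "orbit_type n l a = shape_of (point_list n l a)"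
  by (simp add: orbit_type_def shape_of_def point_list_def Let_def)

lemma excess_shape_of:
  assumes "finite Y" "set xs \<subseteq> Y"
  shows "excess t (shape_of xs) = (\<Sum>v\<in>Y. count_list xs v - t)"
proof -
  have "excess t (shape_of xs) = sum_mset (image_mset (\<lambda>x. x - t) (mset (shape_of xs)))"
    unfolding excess_def by (metis mset_map sum_mset_sum_list)
  also have "mset (shape_of xs) = mset (map (count_list xs) (remdups xs))"
    by (simp add: shape_of_def)
  also have "sum_mset (image_mset (\<lambda>x. x - t) \<dots>) = (\<Sum>v\<leftarrow>remdups xs. count_list xs v - t)"
    by (simp add: sum_mset_sum_list[symmetric] multiset.map_comp o_def)
  also have "\<dots> = (\<Sum>v\<in>set xs. count_list xs v - t)"
    by (simp add: sum_list_distinct_conv_sum_set)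
  also have "\<dots> = (\<Sum>v\<in>Y. count_list xs v - t)"
    using assms by (intro sum.mono_neutral_left) (auto simp: count_list_0_iff)
  finally show ?thesis .
qed

lemma sum_list_shape_of: "sum_list (shape_of xs) = length xs"
  using excess_shape_of[of "set xs" xs 0] sum_count_set[of xs "set xs"] by simp

lemma shape_of_partition: "shape_of xs \<in> partitions (length xs)"
proof -
  have "sorted_wrt (\<ge>) (shape_of xs)"
    unfolding shape_of_def sorted_wrt_rev by (metis sorted_sort)
  moreover have "\<forall>x\<in>set (shape_of xs). 0 < x"
    by (auto simp: shape_of_def count_list_0_iff neq0_conv[symmetric] simp del: neq0_conv)
  ultimately show ?thesis by (simp add: partitions_def sum_list_shape_of)
qed

lemma excess_shape_of_snoc:
  "excess t (shape_of (xs @ [v])) = excess t (shape_of xs) + (if t \<le> count_list xs v then 1 else 0)"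
proof -
  let ?Y = "insert v (set xs)"
  have v: "v \<in> ?Y" by simp
  have "excess t (shape_of (xs @ [v])) = (\<Sum>w\<in>?Y. count_list (xs @ [v]) w - t)"
    by (rule excess_shape_of) auto
  also have "\<dots> = (Suc (count_list xs v) - t) + (\<Sum>w\<in>?Y - {v}. count_list xs w - t)"
    by (subst sum.remove[of _ v]) (auto intro!: sum.cong arg_cong2[of _ _ _ _ "(+)"] split: if_splits)
  also have "\<dots> = (count_list xs v - t) + (\<Sum>w\<in>?Y - {v}. count_list xs w - t) + (if t \<le> count_list xs v then 1 else 0)"
    by auto
  also have "(count_list xs v - t) + (\<Sum>w\<in>?Y - {v}. count_list xs w - t) = (\<Sum>w\<in>?Y. count_list xs w - t)"
    by (rule sum.remove[symmetric]) auto
  also have "\<dots> = excess t (shape_of xs)" by (rule excess_shape_of[symmetric]) auto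
  finally show ?thesis .
qed

text \<open>
  The first \<open>d + 1\<close> parts of the shape are multiplicities of that many distinct values, all at
  least as large as the part with index \<open>d\<close>. If this part is \<open>0\<close>, every value qualifies, and there are
  infinitely many.
\<close>

lemma many_values:
  assumes inf: "infinite (UNIV :: 'k set)"
  shows "\<exists>V. finite V \<and> card V = Suc d \<and> (\<forall>v\<in>V. part (shape_of (xs :: 'k list)) d \<le> count_list xs v)"
proof (cases "part (shape_of xs) d = 0")
  case True
  obtain V :: "'k set" where "finite V" "card V = Suc d"
    using infinite_arbitrarily_large[OF inf, of "Suc d"] by blast
  thus ?thesis using True by auto
next
  case False
  let ?s = "part (shape_of xs) d"
  let ?V = "{v \<in> set xs. ?s \<le> count_list xs v}"
  have "d < length (filter (\<lambda>x. ?s \<le> x) (shape_of xs))"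
    using length_filter_part[OF shape_of_partition] False by blast
  also have "\<dots> = size (filter_mset (\<lambda>x. ?s \<le> x) (mset (shape_of xs)))"
    by (metis mset_filter size_mset)
  also have "\<dots> = length (filter (\<lambda>x. ?s \<le> x) (map (count_list xs) (remdups xs)))"
    by (metis mset_filter size_mset mset_rev mset_sort shape_of_def)
  also have "\<dots> = length (filter (\<lambda>v. ?s \<le> count_list xs v) (remdups xs))"
    by (simp only: filter_map length_map o_def)
  also have "\<dots> = card ?V"
    using distinct_card[of "filter (\<lambda>v. ?s \<le> count_list xs v) (remdups xs)"] by simp
  finally have "Suc d \<le> card ?V" by simp
  then obtain V where "V \<subseteq> ?V" "card V = Suc d" "finite V" by (rule obtain_subset_with_card_n)
  thus ?thesis by blast
qed

lemma length_point_list: "1 \<le> n \<Longrightarrow> length (point_list n l a) = n + l - 1"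
  by (cases "2 \<le> n") (simp_all add: point_list_def)

lemma orbit_type_partitions_ge:
  assumes "1 \<le> n" "1 \<le> l" shows "orbit_type n l a \<in> partitions_ge n l"
proof -
  let ?xs = "point_list n l a"
  have part: "shape_of ?xs \<in> partitions (n + l - 1)"
    using shape_of_partition[of ?xs] by (simp only: length_point_list[OF assms(1)])
  have "l \<le> count_list ?xs (a 1)"
  proof -
    have "count_list (replicate l x) x = l" for x :: 'a by (induction l) simp_all
    thus ?thesis unfolding point_list_def count_list_append by simp
  qed
  moreover have "count_list ?xs (a 1) \<in> set (shape_of ?xs)"
    using assms by (auto simp: shape_of_def point_list_def)
  then obtain i where "i < length (shape_of ?xs)" "count_list ?xs (a 1) = shape_of ?xs ! i"
    by (auto simp: in_set_conv_nth)
  hence "count_list ?xs (a 1) \<le> part (shape_of ?xs) 0"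
    using partition_part_antimono[OF part, of 0 i] by (simp add: part_def)
  ultimately show ?thesis using part by (simp add: orbit_type_eq partitions_ge_iff[OF assms])
qed

lemma point_list_Suc:
  "1 \<le> n \<Longrightarrow> point_list (Suc n) l (a(Suc n := v)) = point_list n l a @ [v]"
  by (auto simp: point_list_def)

lemma orbit_type_cong:
  assumes "1 \<le> n" "\<And>i. i \<in> {1..n} \<Longrightarrow> a i = b i"
  shows "orbit_type n l a = orbit_type n l b"
proof -
  have "point_list n l a = point_list n l b"
    using assms by (auto simp: point_list_def)
  thus ?thesis by (simp add: orbit_type_eq)
qed

section \<open>Coefficients with respect to the last variable\<close>
text \<open>
  The coefficient of the \<open>d\<close>-th power of \<open>X k\<close>, as a polynomial free of \<open>X k\<close>.
\<close>

definition coeff_at :: "nat \<Rightarrow> nat \<Rightarrow> 'k::field mpoly \<Rightarrow> 'k mpoly" where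
  "coeff_at k d f = Abs_poly_mapping (\<lambda>m. if Poly_Mapping.lookup m k = 0
      then Poly_Mapping.lookup f (m + Poly_Mapping.single k d) else 0)"

lemma lookup_coeff_at:
  "Poly_Mapping.lookup (coeff_at k d f) m =
     (if Poly_Mapping.lookup m k = 0 then Poly_Mapping.lookup f (m + Poly_Mapping.single k d) else 0)"
proof -
  let ?h = "\<lambda>m. if Poly_Mapping.lookup m k = 0
      then Poly_Mapping.lookup f (m + Poly_Mapping.single k d) else 0"
  have "{m. ?h m \<noteq> 0} \<subseteq> (\<lambda>m. m - Poly_Mapping.single k d) ` Poly_Mapping.keys f"
  proof
    fix m assume "m \<in> {m. ?h m \<noteq> 0}"
    hence "m + Poly_Mapping.single k d \<in> Poly_Mapping.keys f" by (simp add: in_keys_iff split: if_splits)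
    thus "m \<in> (\<lambda>m. m - Poly_Mapping.single k d) ` Poly_Mapping.keys f"
      by (rule rev_image_eqI) simp
  qed
  hence "finite {m. ?h m \<noteq> 0}" by (rule finite_subset) simp
  thus ?thesis unfolding coeff_at_def by (simp only: lookup_Abs_poly_mapping)
qed

lemma keys_coeff_at:
  "m \<in> Poly_Mapping.keys (coeff_at k d f) \<longleftrightarrow>
     Poly_Mapping.lookup m k = 0 \<and> m + Poly_Mapping.single k d \<in> Poly_Mapping.keys f"
  by (simp add: in_keys_iff lookup_coeff_at)

lemma coeff_at_in_poly_ring:
  assumes "f \<in> carrier (poly_ring (Suc n))"
  shows "coeff_at (Suc n) d f \<in> carrier (poly_ring n)"
  unfolding carrier_poly_ring mem_Collect_eq
proof
  fix m assume m: "m \<in> Poly_Mapping.keys (coeff_at (Suc n) d f)"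
  show "Poly_Mapping.keys m \<subseteq> {1..n}"
  proof
    fix i assume i: "i \<in> Poly_Mapping.keys m"
    hence "i \<in> Poly_Mapping.keys (m + Poly_Mapping.single (Suc n) d)"
      by (simp add: in_keys_iff lookup_add)
    hence "i \<in> {1..Suc n}" using assms m unfolding carrier_poly_ring keys_coeff_at by blast
    moreover have "i \<noteq> Suc n" using i m unfolding keys_coeff_at by (auto simp: in_keys_iff)
    ultimately show "i \<in> {1..n}" by auto
  qed
qed

lemma minus_plus_single:
  "Poly_Mapping.lookup m k = d \<Longrightarrow> m - Poly_Mapping.single k d + Poly_Mapping.single k d = (m :: exponent)"
  by (rule poly_mapping_eqI) (auto simp: lookup_add lookup_minus lookup_single when_def)

text \<open>
  The exponent \<open>d\<close> is that of the variable \<open>X k\<close> in the leading exponent; adding and removing it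
  preserves the order.
\<close>

lemma is_lead_coeff_at:
  assumes "f \<in> carrier (poly_ring k)" "is_lead f m" "d = Poly_Mapping.lookup m k"
  shows "is_lead (coeff_at k d f) (m - Poly_Mapping.single k d)"
proof -
  note mp = minus_plus_single[OF assms(3)[symmetric]]
  have "Poly_Mapping.lookup (m - Poly_Mapping.single k d) k = 0" 
    using assms(3) by (simp add: lookup_minus)
  moreover have "m \<in> Poly_Mapping.keys f" using assms(2) by (simp add: is_lead_def)
  ultimately have "m - Poly_Mapping.single k d \<in> Poly_Mapping.keys (coeff_at k d f)"
    by (simp add: keys_coeff_at mp)
  moreover have "lex_less m' (m - Poly_Mapping.single k d)"
    if m': "m' \<in> Poly_Mapping.keys (coeff_at k d f)" "m' \<noteq> m - Poly_Mapping.single k d" for m'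
  proof -
    have "m' + Poly_Mapping.single k d \<noteq> m" using m'(2) by auto
    hence "lex_less (m' + Poly_Mapping.single k d) m"
      using m'(1) assms(2) unfolding is_lead_def keys_coeff_at by blast
    hence "lex_less (m' + Poly_Mapping.single k d) (m - Poly_Mapping.single k d + Poly_Mapping.single k d)"
      by (simp only: mp)
    thus ?thesis unfolding lex_less_def lookup_add by simp
  qed
  ultimately show ?thesis unfolding is_lead_def by blast
qed

lemma lookup_le_lead:
  assumes "f \<in> carrier (poly_ring k)" "is_lead f m" "m' \<in> Poly_Mapping.keys f"
  shows "Poly_Mapping.lookup m' k \<le> Poly_Mapping.lookup m k"
proof (cases "m' = m")
  case False
  hence "lex_less m' m" using assms by (simp add: is_lead_def)
  then obtain i where i: "Poly_Mapping.lookup m' i < Poly_Mapping.lookup m i"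
    "\<forall>j > i. Poly_Mapping.lookup m' j = Poly_Mapping.lookup m j" unfolding lex_less_def by blast
  have "i \<in> Poly_Mapping.keys m" using i(1) by (simp add: in_keys_iff)
  moreover have "m \<in> Poly_Mapping.keys f" using assms(2) by (simp add: is_lead_def)
  ultimately have "i \<le> k" using assms(1) unfolding carrier_poly_ring by fastforce
  thus ?thesis using i by (cases "i = k") auto
qed simp

lemma eval_coeff_at:
  assumes "\<And>m. m \<in> Poly_Mapping.keys f \<Longrightarrow> Poly_Mapping.lookup m k \<le> D"
  shows "eval_mpoly (a(k := v)) f = (\<Sum>d\<le>D. eval_mpoly a (coeff_at k d f) * v ^ d)"
proof -
  let ?b = "a(k := v)" and ?K = "Poly_Mapping.keys f"
  have "eval_mpoly ?b f = (\<Sum>m\<in>?K. Poly_Mapping.lookup f m * monom_eval ?b m)"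
    by (rule eval_superset) simp_all
  also have "\<dots> = (\<Sum>d\<le>D. \<Sum>m\<in>{m \<in> ?K. Poly_Mapping.lookup m k = d}. Poly_Mapping.lookup f m * monom_eval ?b m)"
    by (rule sum.group[symmetric]) (use assms in auto)
  also have "\<dots> = (\<Sum>d\<le>D. eval_mpoly a (coeff_at k d f) * v ^ d)"
  proof (rule sum.cong[OF refl])
    fix d
    let ?s = "Poly_Mapping.single k d" and ?C = "Poly_Mapping.keys (coeff_at k d f)"
    have bij: "bij_betw (\<lambda>m. m + ?s) ?C {m \<in> ?K. Poly_Mapping.lookup m k = d}"
    proof (rule bij_betwI[where g = "\<lambda>m. m - ?s"])
      show "(\<lambda>m. m + ?s) \<in> ?C \<rightarrow> {m \<in> ?K. Poly_Mapping.lookup m k = d}"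
        by (auto simp: keys_coeff_at lookup_add)
      show "(\<lambda>m. m - ?s) \<in> {m \<in> ?K. Poly_Mapping.lookup m k = d} \<rightarrow> ?C"
        using minus_plus_single[of _ k d] by (auto simp: keys_coeff_at lookup_minus)
    qed (use minus_plus_single[of _ k d] in auto)
    have "monom_eval ?b (m + ?s) = monom_eval a m * v ^ d" if "m \<in> ?C" for m
    proof -
      have "k \<notin> Poly_Mapping.keys m" using that unfolding keys_coeff_at by (simp add: in_keys_iff)
      hence "monom_eval ?b m = monom_eval a m"
        unfolding monom_eval_def by (intro prod.cong) auto
      moreover have "monom_eval ?b ?s = v ^ d" by (cases "d = 0") (simp_all add: monom_eval_def)
      ultimately show ?thesis by (simp add: monom_eval_add)
    qed
    moreover have "Poly_Mapping.lookup f (m + ?s) = Poly_Mapping.lookup (coeff_at k d f) m" if "m \<in> ?C" for m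
      using that by (simp add: keys_coeff_at lookup_coeff_at)
    ultimately have "(\<Sum>m\<in>?C. Poly_Mapping.lookup f (m + ?s) * monom_eval ?b (m + ?s)) =
        (\<Sum>m\<in>?C. Poly_Mapping.lookup (coeff_at k d f) m * monom_eval a m * v ^ d)"
      by (intro sum.cong) simp_all
    moreover have "(\<Sum>m\<in>?C. Poly_Mapping.lookup f (m + ?s) * monom_eval ?b (m + ?s)) =
        (\<Sum>m\<in>{m \<in> ?K. Poly_Mapping.lookup m k = d}. Poly_Mapping.lookup f m * monom_eval ?b m)"
      by (rule sum.reindex_bij_betw[OF bij])
    ultimately show "(\<Sum>m\<in>{m \<in> ?K. Poly_Mapping.lookup m k = d}. Poly_Mapping.lookup f m * monom_eval ?b m) =
        eval_mpoly a (coeff_at k d f) * v ^ d"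
      by (simp add: eval_superset[of ?C] sum_distrib_right)
  qed
  finally show ?thesis .
qed

text \<open>
  Since \<open>X k\<close> is the largest variable, \<open>d\<close> is the degree in it. A univariate polynomial of degree
  at most \<open>d\<close> with \<open>d + 1\<close> zeros has no nonzero coefficient.
\<close>

lemma eval_lead_coeff_at_eq_0:
  assumes f: "f \<in> carrier (poly_ring k)" "is_lead f m" and d: "d = Poly_Mapping.lookup m k"
    and V: "finite V" "card V = Suc d" "\<And>v. v \<in> V \<Longrightarrow> eval_mpoly (a(k := v)) f = 0"
  shows "eval_mpoly a (coeff_at k d f) = 0"
proof -
  \<comment> \<open>the restriction of \<open>f\<close> to the line in direction \<open>k\<close> through \<open>a\<close>\<close>
  define P where "P = (\<Sum>e\<le>d. Polynomial.monom (eval_mpoly a (coeff_at k e f)) e)"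
  have poly_P: "poly P v = eval_mpoly (a(k := v)) f" for v
    using eval_coeff_at[of f k d a v] lookup_le_lead[OF f] d
    by (simp add: P_def poly_sum poly_monom)
  have "P = 0"
  proof (rule ccontr)
    assume "P \<noteq> 0"
    have "V \<subseteq> {v. poly P v = 0}" using V(3) poly_P by auto
    hence "card V \<le> card {v. poly P v = 0}"
      using poly_roots_finite[OF \<open>P \<noteq> 0\<close>] by (intro card_mono)
    also have "\<dots> \<le> Polynomial.degree P" by (rule card_poly_roots_bound[OF \<open>P \<noteq> 0\<close>])
    also have "\<dots> \<le> d" unfolding P_def
      by (rule degree_sum_le) (auto intro: order.trans[OF degree_monom_le])
    finally show False using V(2) by simp
  qed
  hence "0 = Polynomial.coeff P d" by simp
  also have "\<dots> = eval_mpoly a (coeff_at k d f)" by (simp add: P_def coeff_sum)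
  finally show ?thesis by simp
qed

section \<open>Leading exponents of Specht polynomials\<close>

text \<open>
  For a standard tableau this is the leading exponent of its Specht polynomial.
\<close>

definition row_weight :: "nat list \<Rightarrow> (nat \<times> nat \<Rightarrow> nat) \<Rightarrow> exponent" where
  "row_weight lam T = (\<Sum>c\<in>diagram lam. Poly_Mapping.single (T c) (fst c))"

lemma finite_pairs [simp]:
  "finite {(i, i'). i < i' \<and> (i, j) \<in> diagram lam \<and> (i', j) \<in> diagram lam}"
  by (rule finite_subset[of _ "{..<length lam} \<times> {..<length lam}"]) (auto simp: diagram_def)

lemma finite_column_indices [simp]: "finite {i. (i, j) \<in> diagram lam}"
  by (rule finite_subset[of _ "{..<length lam}"]) (auto simp: diagram_def)

text \<open>
  In a strictly increasing column the leading variable of each factor is the one of the lower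
  square, and the square in row \<open>i\<close> is the lower one of exactly \<open>i\<close> pairs.
\<close>

lemma is_lead_specht_poly:
  assumes lam: "lam \<in> partitions m" and T: "T \<in> standard_tableaux n l lam"
  shows "is_lead (specht_poly lam T :: 'k::field mpoly) (row_weight lam T)"
proof -
  let ?A = "\<lambda>j. {(i, i'). i < i' \<and> (i, j) \<in> diagram lam \<and> (i', j) \<in> diagram lam}"
  let ?e = "\<lambda>j. \<Sum>(i, i')\<in>?A j. Poly_Mapping.single (T (i', j)) (1::nat)"
  have "is_lead (column_product lam T j :: 'k mpoly) (?e j)" for j
    unfolding column_product_def
  proof (rule is_lead_prod, goal_cases)
    case (2 x)
    then obtain i i' where x: "x = (i, i')" "i < i'" "(i, j) \<in> diagram lam" "(i', j) \<in> diagram lam" by auto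
    hence "T (i, j) < T (i', j)" using T by (auto simp: standard_tableaux_def)
    from is_lead_X_diff[OF this] show ?case unfolding x by simp
  qed simp
  hence "is_lead (specht_poly lam T :: 'k mpoly) (\<Sum>j\<in>snd ` diagram lam. ?e j)"
    unfolding specht_poly_def by (intro is_lead_prod) simp_all
  also have "(\<Sum>j\<in>snd ` diagram lam. ?e j) = row_weight lam T"
  proof -
    have "?e j = (\<Sum>i'\<in>{i'. (i', j) \<in> diagram lam}. Poly_Mapping.single (T (i', j)) i')" for j
    proof -
      have "?A j = (\<lambda>(i', i). (i, i')) ` (SIGMA i':{i'. (i', j) \<in> diagram lam}. {..<i'})"
      proof -
        have "(i, j) \<in> diagram lam" if "(i', j) \<in> diagram lam" "i < i'" for i i'
          using that partition_part_antimono[OF lam, of i i'] by (simp add: diagram_iff)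
        thus ?thesis by (auto simp: image_iff)
      qed
      hence "?e j = (\<Sum>(i', i)\<in>(SIGMA i':{i'. (i', j) \<in> diagram lam}. {..<i'}). Poly_Mapping.single (T (i', j)) 1)"
        by (simp only:) (subst sum.reindex, auto simp: inj_on_def intro!: sum.cong)
      also have "\<dots> = (\<Sum>i'\<in>{i'. (i', j) \<in> diagram lam}. \<Sum>i<i'. Poly_Mapping.single (T (i', j)) 1)"
        by (rule sum.Sigma[symmetric]) simp_all
      also have "\<dots> = (\<Sum>i'\<in>{i'. (i', j) \<in> diagram lam}. Poly_Mapping.single (T (i', j)) i')"
      proof (rule sum.cong[OF refl])
        fix i'
        have "(\<Sum>i<N. Poly_Mapping.single c (1::nat)) = Poly_Mapping.single c N" for N c :: nat
          by (induction N) (simp_all add: single_add[symmetric] del: sum_constant)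
        thus "(\<Sum>i<i'. Poly_Mapping.single (T (i', j)) (1::nat)) = Poly_Mapping.single (T (i', j)) i'" .
      qed
      finally show ?thesis .
    qed
    hence "(\<Sum>j\<in>snd ` diagram lam. ?e j) =
      (\<Sum>j\<in>snd ` diagram lam. \<Sum>i'\<in>{i'. (i', j) \<in> diagram lam}. Poly_Mapping.single (T (i', j)) i')" by simp
    also have "\<dots> = (\<Sum>(j, i')\<in>(SIGMA j:snd ` diagram lam. {i'. (i', j) \<in> diagram lam}). Poly_Mapping.single (T (i', j)) i')"
      by (rule sum.Sigma) simp_all
    also have "\<dots> = row_weight lam T"
      unfolding row_weight_def
      by (rule sum.reindex_bij_witness[where i = "\<lambda>(i, j). (j, i)" and j = "\<lambda>(j, i). (i, j)"])
        (auto intro: rev_image_eqI)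
    finally show ?thesis .
  qed
  finally show ?thesis .
qed

section \<open>Standard tableaux below a leading exponent\<close>

lemma tableauxD:
  assumes "T \<in> tableaux n l lam"
  shows "c \<notin> diagram lam \<Longrightarrow> T c = undefined"
    and "image_mset T (mset_set (diagram lam)) = replicate_mset l 1 + mset_set {2..n}"
    and "(i, j) \<in> diagram lam \<Longrightarrow> (i', j) \<in> diagram lam \<Longrightarrow> T (i, j) = 1 \<Longrightarrow> T (i', j) = 1 \<Longrightarrow> i = i'"
proof -
  note T = assms[unfolded tableaux_def mem_Collect_eq]
  show "c \<notin> diagram lam \<Longrightarrow> T c = undefined"
    by (rule extensional_arb[OF conjunct1[OF T]])
  show "image_mset T (mset_set (diagram lam)) = replicate_mset l 1 + mset_set {2..n}"
    by (rule conjunct1[OF conjunct2[OF T]])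
  show "(i, j) \<in> diagram lam \<Longrightarrow> (i', j) \<in> diagram lam \<Longrightarrow> T (i, j) = 1 \<Longrightarrow> T (i', j) = 1 \<Longrightarrow> i = i'"
    using conjunct2[OF conjunct2[OF T]] by blast
qed

lemma tableau_entries:
  assumes "T \<in> tableaux n l lam" "c \<in> diagram lam" "1 \<le> n"
  shows "T c \<in> {1..n}"
proof -
  have "image_mset T (mset_set (diagram lam)) = replicate_mset l 1 + mset_set {2..n}"
    by (rule tableauxD(2)[OF assms(1)])
  hence "T c \<in># replicate_mset l 1 + mset_set {2..n}"
    using assms(2) by (metis finite_diagram finite_set_mset_mset_set imageI set_image_mset)
  thus ?thesis using assms(3) by (auto simp: in_replicate_mset split: if_splits)
qed

text \<open>
  The new entry is larger than all others, and nothing lies below or to the right of the new box.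
\<close>

lemma extend_standard_tableau:
  fixes d :: nat
  assumes n: "1 \<le> n" and lam: "lam \<in> partitions m" and T: "T \<in> standard_tableaux n l lam"
  defines "c \<equiv> (box_row d lam, part lam d)"
  shows "T(c := Suc n) \<in> standard_tableaux (Suc n) l (add_box d lam)"
    and "row_weight (add_box d lam) (T(c := Suc n)) = row_weight lam T + Poly_Mapping.single (Suc n) (box_row d lam)"
proof -
  let ?T = "T(c := Suc n)"
  note D = diagram_add_box[OF lam, of d, folded c_def]
  have T': "T \<in> tableaux n l lam" using T by (simp add: standard_tableaux_def)
  have entries: "T c' \<le> n" if "c' \<in> diagram lam" for c'
    using tableau_entries[OF T' that n] by simp
  have out: "c' \<noteq> c" if "c' \<in> diagram lam" for c' using that D(2) by auto
  have ms: "image_mset ?T (mset_set (diagram lam)) = image_mset T (mset_set (diagram lam))"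
    using D(2) by (intro image_mset_cong) auto
  have "{2..Suc n} = insert (Suc n) {2..n}" using n by auto
  hence s: "mset_set {2..Suc n} = add_mset (Suc n) (mset_set {2..n})" by simp
  have tab: "?T \<in> tableaux (Suc n) l (add_box d lam)"
    unfolding tableaux_def mem_Collect_eq
  proof (intro conjI allI impI)
    show "?T \<in> extensional (diagram (add_box d lam))"
      unfolding D(1) extensional_def using tableauxD(1)[OF T'] by simp
    show "image_mset ?T (mset_set (diagram (add_box d lam))) = replicate_mset l 1 + mset_set {2..Suc n}"
      using D(2) unfolding D(1) s by (simp add: ms tableauxD(2)[OF T'])
    fix i i' j
    assume "(i, j) \<in> diagram (add_box d lam) \<and> (i', j) \<in> diagram (add_box d lam) \<and> ?T (i, j) = 1 \<and> ?T (i', j) = 1"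
    hence "(i, j) \<in> diagram lam" "(i', j) \<in> diagram lam" "T (i, j) = 1" "T (i', j) = 1"
      using n unfolding D(1) by (auto split: if_splits)
    thus "i = i'" by (rule tableauxD(3)[OF T'])
  qed
  show "?T \<in> standard_tableaux (Suc n) l (add_box d lam)"
    unfolding standard_tableaux_def mem_Collect_eq
  proof (intro conjI allI impI tab)
    fix i i' j
    assume a: "(i, j) \<in> diagram (add_box d lam) \<and> (i', j) \<in> diagram (add_box d lam) \<and> i < i'"
    have ne: "(i, j) \<noteq> c"
    proof
      assume ij: "(i, j) = c"
      hence "(i', j) \<in> diagram lam" using a unfolding D(1) by auto
      hence "(i, j) \<in> diagram lam" using a partition_part_antimono[OF lam, of i i'] by (simp add: diagram_iff)
      thus False using ij D(2) by simp
    qed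
    hence ij: "(i, j) \<in> diagram lam" using a unfolding D(1) by simp
    show "?T (i, j) < ?T (i', j)"
    proof (cases "(i', j) = c")
      case True
      thus ?thesis using ne entries[OF ij] by simp
    next
      case False
      hence "(i', j) \<in> diagram lam" using a unfolding D(1) by simp
      hence "T (i, j) < T (i', j)" using T ij a unfolding standard_tableaux_def by blast
      thus ?thesis using ne False by simp
    qed
  next
    fix i j j'
    assume a: "(i, j) \<in> diagram (add_box d lam) \<and> (i, j') \<in> diagram (add_box d lam) \<and> j < j'"
    have ne: "(i, j) \<noteq> c"
    proof
      assume ij: "(i, j) = c"
      hence "(i, j') \<in> diagram lam" using a unfolding D(1) by auto
      hence "(i, j) \<in> diagram lam" using a by (simp add: diagram_iff)
      thus False using ij D(2) by simp
    qed
    hence ij: "(i, j) \<in> diagram lam" using a unfolding D(1) by simp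
    show "?T (i, j) \<le> ?T (i, j')"
    proof (cases "(i, j') = c")
      case True
      thus ?thesis using ne entries[OF ij] by simp
    next
      case False
      hence "(i, j') \<in> diagram lam" using a unfolding D(1) by simp
      hence "T (i, j) \<le> T (i, j')" using T ij a unfolding standard_tableaux_def by blast
      thus ?thesis using ne False by simp
    qed
  qed
  have "(\<Sum>c'\<in>diagram lam. Poly_Mapping.single (?T c') (fst c')) = row_weight lam T"
    unfolding row_weight_def using D(2) by (intro sum.cong) auto
  thus "row_weight (add_box d lam) ?T = row_weight lam T + Poly_Mapping.single (Suc n) (box_row d lam)"
    unfolding row_weight_def[of "add_box d lam"] D(1) using D(2) by (simp add: c_def add.commute)
qed

lemma partitions_ge_1:
  assumes "1 \<le> l" shows "partitions_ge 1 l = {[l]}"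
proof -
  have "lam = [l]" if lam: "lam \<in> partitions_ge 1 l" for lam
  proof (cases lam)
    case Nil
    thus ?thesis using lam assms by (simp add: partitions_ge_def partitions_def)
  next
    case (Cons x xs)
    hence "x = l" "sum_list xs = 0" "\<forall>y\<in>set xs. 0 < y" using lam
      by (auto simp: partitions_ge_def partitions_def)
    thus ?thesis using Cons by (cases xs) auto
  qed
  moreover have "[l] \<in> partitions_ge 1 l" using assms by (simp add: partitions_ge_def partitions_def)
  ultimately show ?thesis by blast
qed

lemma single_row_tableau:
  fixes l :: nat
  defines "T \<equiv> restrict (\<lambda>_. 1) (diagram [l])"
  shows "T \<in> standard_tableaux 1 l [l]" and "\<And>i. Poly_Mapping.lookup (row_weight [l] T) i = 0"
proof -
  have D: "diagram [l] = {0} \<times> {..<l}" by (auto simp: diagram_def)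
  have "image_mset T (mset_set (diagram [l])) = image_mset (\<lambda>_. 1) (mset_set (diagram [l]))"
    unfolding T_def by (intro image_mset_cong) simp
  also have "\<dots> = replicate_mset l 1"
    unfolding D by (simp add: image_mset_const_eq)
  finally show "T \<in> standard_tableaux 1 l [l]"
    by (auto simp: standard_tableaux_def tableaux_def T_def D)
  have "row_weight [l] T = 0" unfolding row_weight_def D by (intro sum.neutral) auto
  thus "\<And>i. Poly_Mapping.lookup (row_weight [l] T) i = 0" by simp
qed

text \<open>
  If a polynomial vanishes at the points whose orbit type lies outside \<open>F\<close>, this is the filter
  outside of which its leading coefficient in the last variable vanishes, when that variable has
  exponent \<open>d\<close>.
\<close>

lemma lower_filter_remove_box:
  assumes n: "1 \<le> n" "1 \<le> l" and F: "lower_filter (Suc n) l F"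
  shows "lower_filter n l {mu \<in> partitions_ge n l. add_box d mu \<in> F}"
  unfolding lower_filter_def
proof (intro conjI ballI impI)
  fix mu nu
  assume mu: "mu \<in> {mu \<in> partitions_ge n l. add_box d mu \<in> F}" and nu: "nu \<in> partitions_ge n l"
    and dom: "dominated nu mu"
  have p: "mu \<in> partitions (n + l - 1)" "nu \<in> partitions (n + l - 1)"
    using mu nu by (auto simp: partitions_ge_def)
  have p': "add_box d mu \<in> partitions_ge (Suc n) l" "add_box d nu \<in> partitions_ge (Suc n) l"
    using mu nu n by (auto intro: add_box_partitions_ge)
  have "\<forall>t. excess t nu \<le> excess t mu" using dom dominated_iff_excess[OF p(2,1)] by simp
  hence "\<forall>t. excess t (add_box d nu) \<le> excess t (add_box d mu)"
    using add_box_mono[OF p] by blast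
  hence "dominated (add_box d nu) (add_box d mu)"
    using dominated_iff_excess[of "add_box d nu" "Suc n + l - 1" "add_box d mu"] p'
    by (simp add: partitions_ge_def)
  thus "nu \<in> {mu \<in> partitions_ge n l. add_box d mu \<in> F}"
    using F mu nu p' unfolding lower_filter_def by blast
qed blast

text \<open>
  The induction peels off the last variable. In one variable only the shape \<open>[l]\<close> exists, whose
  Specht polynomial is \<open>1\<close>; were it outside the filter, \<open>f\<close> would vanish everywhere, which a
  nonzero polynomial over an infinite field does not.
\<close>

theorem standard_tableau_below_lead:
  fixes f :: "'k::field mpoly"
  assumes inf: "infinite (UNIV :: 'k set)" and l: "1 \<le> l" and n: "1 \<le> n"
    and F: "lower_filter n l F" and f: "f \<in> carrier (poly_ring n)" and m: "is_lead f m"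
    and van: "\<And>a. orbit_type n l a \<notin> F \<Longrightarrow> eval_mpoly a f = 0"
  shows "\<exists>mu\<in>F. \<exists>T\<in>standard_tableaux n l mu. \<forall>i. Poly_Mapping.lookup (row_weight mu T) i \<le> Poly_Mapping.lookup m i"
  using n F f m van
proof (induction n arbitrary: F f m rule: nat_induct_at_least)
  case base
  have "[l] \<in> F"
  proof (rule ccontr)
    assume "[l] \<notin> F"
    hence van: "eval_mpoly a f = 0" for a
      using base.prems(4)[of a] orbit_type_partitions_ge[of 1 l a] partitions_ge_1[OF l] l by auto
    define d where "d = Poly_Mapping.lookup m 1"
    obtain V :: "'k set" where V: "finite V" "card V = Suc d"
      using infinite_arbitrarily_large[OF inf, of "Suc d"] by blast
    have 0: "eval_mpoly (\<lambda>_. 0) (coeff_at 1 d f) = 0"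
      by (rule eval_lead_coeff_at_eq_0[OF base.prems(2,3) d_def V]) (rule van)
    have lead: "is_lead (coeff_at 1 d f) (m - Poly_Mapping.single 1 d)"
      by (rule is_lead_coeff_at[OF base.prems(2,3) d_def])
    have "coeff_at 1 d f \<in> carrier (poly_ring 0)"
      using coeff_at_in_poly_ring[of f 0] base.prems(2) by simp
    hence "Poly_Mapping.keys (coeff_at 1 d f) \<subseteq> {0}"
      by (auto simp: carrier_poly_ring)
    hence sub: "eval_mpoly (\<lambda>_. 0) (coeff_at 1 d f) = Poly_Mapping.lookup (coeff_at 1 d f) 0"
      "m - Poly_Mapping.single 1 d = 0"
      using lead eval_superset[of "{0}" "coeff_at 1 d f"]
      by (auto simp: monom_eval_def is_lead_def)
    thus False using 0 lead by (simp add: is_lead_def in_keys_iff)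
  qed
  thus ?case using single_row_tableau[of l] by (metis le0)
next
  case (Suc n)
  define d where "d = Poly_Mapping.lookup m (Suc n)"
  let ?F = "{mu \<in> partitions_ge n l. add_box d mu \<in> F}"
  let ?g = "coeff_at (Suc n) d f" and ?s = "Poly_Mapping.single (Suc n) d"
  have "\<exists>mu\<in>?F. \<exists>T\<in>standard_tableaux n l mu. \<forall>i. Poly_Mapping.lookup (row_weight mu T) i \<le> Poly_Mapping.lookup (m - ?s) i"
  proof (rule Suc.IH)
    show "lower_filter n l ?F" by (rule lower_filter_remove_box[OF Suc.hyps l Suc.prems(1)])
    show "?g \<in> carrier (poly_ring n)" by (rule coeff_at_in_poly_ring[OF Suc.prems(2)])
    show "is_lead ?g (m - ?s)" by (rule is_lead_coeff_at[OF Suc.prems(2,3) d_def])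
  next
    fix a :: "nat \<Rightarrow> 'k"
    assume a: "orbit_type n l a \<notin> ?F"
    let ?xs = "point_list n l a" and ?mu = "orbit_type n l a"
    have mu: "?mu \<in> partitions_ge n l" by (rule orbit_type_partitions_ge[OF Suc.hyps l])
    hence mu': "?mu \<in> partitions (n + l - 1)" by (simp add: partitions_ge_def)
    have nF: "add_box d ?mu \<notin> F" using a mu by simp
    \<comment> \<open>extending \<open>a\<close> by any of these values stays outside the filter\<close>
    obtain V where V: "finite V" "card V = Suc d" "\<And>v. v \<in> V \<Longrightarrow> part ?mu d \<le> count_list ?xs v"
      using many_values[OF inf, of d ?xs] unfolding orbit_type_eq by blast
    show "eval_mpoly a ?g = 0"
    proof (rule eval_lead_coeff_at_eq_0[OF Suc.prems(2,3) d_def V(1,2)])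
      fix v assume v: "v \<in> V"
      let ?nu = "orbit_type (Suc n) l (a(Suc n := v))"
      have nu: "?nu \<in> partitions_ge (Suc n) l" using l by (intro orbit_type_partitions_ge) simp_all
      have "excess t (add_box d ?mu) \<le> excess t ?nu" for t
        using V(3)[OF v] unfolding excess_add_box[OF mu'] orbit_type_eq[of "Suc n"] point_list_Suc[OF Suc.hyps]
          excess_shape_of_snoc unfolding orbit_type_eq[of n] by auto
      hence "dominated (add_box d ?mu) ?nu"
        using nu add_box_partitions_ge[OF Suc.hyps l mu, of d]
          dominated_iff_excess[of "add_box d ?mu" "Suc n + l - 1" ?nu] by (simp add: partitions_ge_def)
      hence "?nu \<notin> F"
        using nF Suc.prems(1) add_box_partitions_ge[OF Suc.hyps l mu, of d] unfolding lower_filter_def by blast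
      thus "eval_mpoly (a(Suc n := v)) f = 0" by (rule Suc.prems(4))
    qed
  qed
  then obtain mu T where mu: "mu \<in> partitions_ge n l" "add_box d mu \<in> F" and T: "T \<in> standard_tableaux n l mu"
    and le: "\<And>i. Poly_Mapping.lookup (row_weight mu T) i \<le> Poly_Mapping.lookup (m - ?s) i" by blast
  have mu': "mu \<in> partitions (n + l - 1)" using mu by (simp add: partitions_ge_def)
  note T' = extend_standard_tableau[OF Suc.hyps mu' T, of d]
  have "Poly_Mapping.lookup (row_weight (add_box d mu) (T((box_row d mu, part mu d) := Suc n))) i \<le> Poly_Mapping.lookup m i" for i
    using le[of i] box_row_le[of d mu] d_def unfolding T'(2)
    by (auto simp: lookup_add lookup_minus lookup_single when_def)
  thus ?case using mu(2) T'(1) by blast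
qed

section \<open>Zeros of Specht polynomials\<close>
lemma excess_eq_card: "excess t lam = card {c \<in> diagram lam. t \<le> snd c}"
proof -
  have "{c \<in> diagram lam. t \<le> snd c} = (SIGMA i:{..<length lam}. {t..<part lam i})"
    by (auto simp: diagram_iff part_def split: if_splits)
  hence "card {c \<in> diagram lam. t \<le> snd c} = (\<Sum>i<length lam. part lam i - t)" by simp
  thus ?thesis using excess_eq_sum_part[of lam "length lam" t] by simp
qed

lemma mset_point_list: "mset (point_list n l a) = image_mset a (replicate_mset l 1 + mset_set {2..n})"
  by (simp add: point_list_def atLeastLessThanSuc_atLeastAtMost del: upt_Suc)

lemma count_image_mset_set:
  "finite D \<Longrightarrow> count (image_mset f (mset_set D)) v = card {c \<in> D. f c = v}"
  by (simp add: count_image_mset vimage_def Int_def conj_commute)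

text \<open>
  At a nonzero of the Specht polynomial every column takes each value at most once. A value of
  multiplicity \<open>c\<close> therefore fills at most \<open>t\<close> squares in the first \<open>t\<close> columns, and at least
  \<open>c - t\<close> squares beyond them.
\<close>

lemma excess_orbit_type_le:
  assumes T: "T \<in> tableaux n l lam" and nz: "eval_mpoly a (specht_poly lam T) \<noteq> 0"
  shows "excess t (orbit_type n l a) \<le> excess t lam"
proof -
  let ?D = "diagram lam" and ?xs = "point_list n l a"
  let ?B = "\<lambda>v. {c \<in> ?D. a (T c) = v}"
  have distinct: "a (T (i, j)) \<noteq> a (T (i', j))" if "(i, j) \<in> ?D" "(i', j) \<in> ?D" "i < i'" for i i' j
  proof -
    have "j \<in> snd ` ?D" using that(1) by force
    hence "eval_mpoly a (column_product lam T j) \<noteq> 0"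
      using nz unfolding specht_poly_def eval_prod by (meson finite_diagram finite_imageI prod_zero)
    hence "eval_mpoly a (X (T (i, j)) - X (T (i', j))) \<noteq> 0"
      using that unfolding column_product_def eval_prod by (auto simp: prod_zero_iff)
    thus ?thesis by simp
  qed
  have inj: "inj_on snd (?B v)" for v
  proof (rule inj_onI)
    fix c c' assume cc': "c \<in> ?B v" "c' \<in> ?B v" "snd c = snd c'"
    obtain i i' j where eq: "c = (i, j)" "c' = (i', j)" using cc'(3) by (cases c, cases c') simp
    have c: "(i, j) \<in> ?D" "(i', j) \<in> ?D" "a (T (i', j)) = a (T (i, j))" using cc' eq by simp_all
    have "i = i'"
    proof (rule ccontr)
      assume "i \<noteq> i'"
      then consider "i < i'" | "i' < i" by linarith
      thus False using distinct[of i j i'] distinct[of i' j i] c by cases simp_all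
    qed
    thus "c = c'" using eq by simp
  qed
  have cnt: "count_list ?xs v = card (?B v)" for v
  proof -
    have "mset ?xs = image_mset (\<lambda>c. a (T c)) (mset_set ?D)"
      unfolding mset_point_list tableauxD(2)[OF T, symmetric] by (simp add: multiset.map_comp o_def)
    moreover have "count (mset ?xs) v = count_list ?xs v" by (rule count_mset)
    ultimately show ?thesis using count_image_mset_set[of ?D "\<lambda>c. a (T c)" v] by simp
  qed
  have bound: "count_list ?xs v - t \<le> card {c \<in> ?B v. t \<le> snd c}" for v
  proof -
    define B where "B = ?B v"
    have fin: "finite B" unfolding B_def by simp
    have "B = {c \<in> B. snd c < t} \<union> {c \<in> B. t \<le> snd c}" by auto
    hence "card B \<le> card {c \<in> B. snd c < t} + card {c \<in> B. t \<le> snd c}"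
      using card_Un_le[of "{c \<in> B. snd c < t}" "{c \<in> B. t \<le> snd c}"] by simp
    moreover have "card {c \<in> B. snd c < t} \<le> card {..<t}"
    proof (rule card_inj_on_le[where f = snd])
      show "inj_on snd {c \<in> B. snd c < t}"
        unfolding B_def by (rule inj_on_subset[OF inj[of v]]) blast
      show "snd ` {c \<in> B. snd c < t} \<subseteq> {..<t}" by blast
    qed simp
    moreover have "{c \<in> ?B v. t \<le> snd c} = {c \<in> B. t \<le> snd c}" by (simp add: B_def)
    ultimately show ?thesis unfolding cnt by (simp add: B_def)
  qed
  have "excess t (orbit_type n l a) = (\<Sum>v\<in>set ?xs. count_list ?xs v - t)"
    unfolding orbit_type_eq by (rule excess_shape_of) simp_all
  also have "\<dots> \<le> (\<Sum>v\<in>set ?xs. card {c \<in> ?B v. t \<le> snd c})" by (rule sum_mono) (rule bound)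
  also have "\<dots> = card (\<Union>v\<in>set ?xs. {c \<in> ?B v. t \<le> snd c})"
    by (rule card_UN_disjoint[symmetric]) auto
  also have "\<dots> \<le> card {c \<in> ?D. t \<le> snd c}" by (rule card_mono) auto
  also have "\<dots> = excess t lam" by (rule excess_eq_card[symmetric])
  finally show ?thesis .
qed

lemma ideal_vanishing: "ideal (vanishing_ideal n l F :: 'k::field mpoly set) (poly_ring n)"
  by (rule conjunct1[OF radical_vanishing_ideal[unfolded radical_ideal_def]])

lemma specht_poly_in_poly_ring:
  assumes "T \<in> tableaux n l lam" "1 \<le> n"
  shows "specht_poly lam T \<in> carrier (poly_ring n)"
  unfolding specht_poly_def column_product_def
  by (intro poly_ring_prod) (use tableau_entries[OF assms(1) _ assms(2)] in
    \<open>auto intro!: poly_ring_diff X_in_poly_ring simp del: atLeastAtMost_iff\<close>)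

lemma specht_gens_carrier:
  "1 \<le> n \<Longrightarrow> specht_poly lam ` tableaux n l lam \<subseteq> carrier (poly_ring n)"
  using specht_poly_in_poly_ring by blast

lemma ideal_specht_ideal:
  "1 \<le> n \<Longrightarrow> ideal (specht_ideal n l lam :: 'k::field mpoly set) (poly_ring n)"
  unfolding specht_ideal_def by (rule genideal_poly_ring(1)[OF specht_gens_carrier])

lemma specht_poly_in_specht_ideal:
  assumes "1 \<le> n" "T \<in> tableaux n l lam"
  shows "specht_poly lam T \<in> specht_ideal n l lam"
  unfolding specht_ideal_def using genideal_poly_ring(2)[OF specht_gens_carrier[OF assms(1)]] assms(2) by blast

section \<open>Division and Groebner bases\<close>

text \<open>
  For an ideal \<open>J\<close> and a finite \<open>G \<subseteq> J\<close> this is the Groebner basis property of \<open>G\<close>, in terms of exponents.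
\<close>

definition leads_divide :: "'k::field mpoly set \<Rightarrow> 'k mpoly set \<Rightarrow> bool" where
  "leads_divide G J \<longleftrightarrow> (\<forall>f\<in>J. \<forall>m. is_lead f m \<longrightarrow>
     (\<exists>g\<in>G. \<exists>e. is_lead g e \<and> (\<forall>i. Poly_Mapping.lookup e i \<le> Poly_Mapping.lookup m i)))"

lemma minus_plus_exponent:
  "(\<And>i. Poly_Mapping.lookup e i \<le> Poly_Mapping.lookup m i) \<Longrightarrow> m - e + e = (m :: exponent)"
  by (rule poly_mapping_eqI) (simp add: lookup_add lookup_minus)

lemma keys_lead_subset:
  "f \<in> carrier (poly_ring n) \<Longrightarrow> is_lead f m \<Longrightarrow> Poly_Mapping.keys m \<subseteq> {1..n}"
  by (simp add: is_lead_def carrier_poly_ring)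

lemma keys_minus_exponent: "Poly_Mapping.keys (m - e) \<subseteq> Poly_Mapping.keys (m :: exponent)"
  by (auto simp: in_keys_iff lookup_minus)

text \<open>
  Subtracting the multiple of an element of \<open>G\<close> with the same leading term lowers the leading
  exponent; the order is well-founded.
\<close>

lemma leads_divide_imp_subset:
  fixes G J :: "'k::field mpoly set"
  assumes J: "ideal J (poly_ring n)" and GJ: "G \<subseteq> J" and div: "leads_divide G J"
  shows "J \<subseteq> Idl\<^bsub>poly_ring n\<^esub> G"
proof -
  let ?I = "Idl\<^bsub>poly_ring n\<^esub> G"
  have Gc: "G \<subseteq> carrier (poly_ring n)" using GJ ideal_sub[OF J] by blast
  note I = genideal_poly_ring(1,2)[OF Gc]
  have "f \<in> ?I" if "f \<in> J" "is_lead f m" for f m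
    using that
  proof (induction m arbitrary: f rule: wf_induct_rule[OF wf_lex_less[of n]])
    case (1 m)
    have fc: "f \<in> carrier (poly_ring n)" using 1(2) ideal_sub[OF J] by blast
    obtain g e where g: "g \<in> G" "is_lead g e" and
      le: "\<And>i. Poly_Mapping.lookup e i \<le> Poly_Mapping.lookup m i"
      using div 1(2,3) unfolding leads_divide_def by blast
    obtain c f' where f': "c \<noteq> 0" "f = Poly_Mapping.single m c + f'" "\<forall>k \<in> Poly_Mapping.keys f'. lex_less k m"
      using 1(3) unfolding is_lead_iff by blast
    obtain d g' where g': "d \<noteq> 0" "g = Poly_Mapping.single e d + g'" "\<forall>k \<in> Poly_Mapping.keys g'. lex_less k e"
      using g(2) unfolding is_lead_iff by blast
    let ?q = "Poly_Mapping.single (m - e) (c / d)"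
    have me: "m - e + e = m" "e + (m - e) = m"
      using minus_plus_exponent[OF le] by (simp_all add: add.commute)
    have "Poly_Mapping.keys (m - e) \<subseteq> {1..n}"
      using keys_lead_subset[OF fc 1(3)] keys_minus_exponent[of m e] by blast
    hence qc: "?q \<in> carrier (poly_ring n)" by (rule poly_ring_single)
    \<comment> \<open>the terms with exponent \<open>m\<close> cancel\<close>
    let ?h = "f - ?q * g"
    have h_eq: "?h = f' - ?q * g'"
      unfolding f'(2) g'(2) using g'(1) by (simp add: algebra_simps mult_single me)
    have hJ: "?h \<in> J"
      using ideal_add[OF J 1(2) ideal_uminus[OF J ideal_mult[OF J qc]]] g(1) GJ by auto
    have less: "lex_less k m" if k: "k \<in> Poly_Mapping.keys ?h" for k
    proof -
      have "k \<in> Poly_Mapping.keys f' \<or> k \<in> Poly_Mapping.keys (?q * g')"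
        using k unfolding h_eq by (auto simp: in_keys_iff lookup_minus)
      thus ?thesis
      proof
        assume "k \<in> Poly_Mapping.keys (?q * g')"
        then obtain k1 k2 where k12: "k1 \<in> Poly_Mapping.keys ?q" "k2 \<in> Poly_Mapping.keys g'" "k = k1 + k2"
          using keys_mult[of ?q g'] by blast
        have "k1 = m - e" using k12(1) by (simp split: if_splits)
        thus ?thesis using k12 g'(3) lex_less_add_right[of k2 e "m - e"] me by (simp add: add.commute)
      qed (use f'(3) in blast)
    qed
    have hI: "?h \<in> ?I"
    proof (cases "?h = 0")
      case True
      show ?thesis unfolding True by (rule ideal_zero[OF I(1)])
    next
      case False
      then obtain m' where m': "is_lead ?h m'" using is_lead_exists by blast
      hence "lex_less m' m" using less by (simp add: is_lead_def)
      moreover have "Poly_Mapping.keys m' \<subseteq> {1..n}" "Poly_Mapping.keys m \<subseteq> {1..n}"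
        using keys_lead_subset[OF _ m'] keys_lead_subset[OF fc 1(3)] hJ ideal_sub[OF J] by blast+
      ultimately show ?thesis using 1(1)[OF _ hJ m'] by blast
    qed
    have "?q * g \<in> ?I" using g(1) I(2) by (intro ideal_mult[OF I(1) qc]) blast
    from ideal_add[OF I(1) hI this] show ?case by simp
  qed
  moreover have "\<exists>m. is_lead f m" if "f \<noteq> 0" for f :: "'k mpoly" using that by (rule is_lead_exists)
  ultimately show ?thesis using ideal_zero[OF I(1)] by (metis subsetI)
qed

lemma initial_monomial_in_poly_ring:
  assumes "f \<in> carrier (poly_ring n)" "f \<noteq> 0" shows "initial_monomial f \<in> carrier (poly_ring n)"
proof -
  obtain m where m: "is_lead f m" using is_lead_exists[OF assms(2)] by blast
  show ?thesis unfolding initial_monomial_eq[OF m]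
    by (rule poly_ring_single) (rule keys_lead_subset[OF assms(1) m])
qed

lemma leads_divide_imp_groebner:
  fixes G J :: "'k::field mpoly set"
  assumes J: "ideal J (poly_ring n)" and GJ: "G \<subseteq> J" and div: "leads_divide G J" and fin: "finite G"
  shows "is_groebner_basis n G J"
proof -
  let ?M = "\<lambda>A. {initial_monomial f | f. f \<in> A \<and> f \<noteq> (0 :: 'k mpoly)}"
  have Jc: "J \<subseteq> carrier (poly_ring n)" by (rule ideal_sub[OF J])
  have c: "?M J \<subseteq> carrier (poly_ring n)" "?M G \<subseteq> carrier (poly_ring n)"
    using Jc GJ initial_monomial_in_poly_ring[of _ n] by blast+
  have "initial_ideal n G \<subseteq> initial_ideal n J"
    unfolding initial_ideal_def
    by (rule genideal_poly_ring(3)[OF c(2) genideal_poly_ring(1)[OF c(1)]])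
      (use genideal_poly_ring(2)[OF c(1)] GJ in blast)
  moreover have "initial_ideal n J \<subseteq> initial_ideal n G"
    unfolding initial_ideal_def
  proof (rule genideal_poly_ring(3)[OF c(1) genideal_poly_ring(1)[OF c(2)]], clarify)
    fix f :: "'k mpoly" assume f: "f \<in> J" "f \<noteq> 0"
    obtain m where m: "is_lead f m" using is_lead_exists[OF f(2)] by blast
    obtain g e where g: "g \<in> G" "is_lead g e" and
      le: "\<And>i. Poly_Mapping.lookup e i \<le> Poly_Mapping.lookup m i"
      using div f(1) m unfolding leads_divide_def by blast
    have "Poly_Mapping.keys (m - e) \<subseteq> {1..n}"
      using keys_lead_subset[OF _ m] f(1) Jc keys_minus_exponent[of m e] by blast
    hence qc: "Poly_Mapping.single (m - e) 1 \<in> carrier (poly_ring n)" by (rule poly_ring_single)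
    have "g \<noteq> 0" using g(2) by (auto simp: is_lead_def)
    hence "initial_monomial g \<in> Idl\<^bsub>poly_ring n\<^esub> (?M G)"
      using genideal_poly_ring(2)[OF c(2)] g(1) by blast
    from ideal_mult[OF genideal_poly_ring(1)[OF c(2)] qc this]
    show "initial_monomial f \<in> Idl\<^bsub>poly_ring n\<^esub> (?M G)"
      unfolding initial_monomial_eq[OF m] initial_monomial_eq[OF g(2)]
      by (simp add: mult_single minus_plus_exponent[OF le])
  qed
  ultimately show ?thesis using fin GJ by (simp add: is_groebner_basis_def)
qed

section \<open>The exchange identity for Vandermonde products\<close>
text \<open>
  The weights make \<open>V * h\<close> agree at all \<open>x a\<close> with the Lagrange interpolation sum of \<open>h\<close>. Both have degree
  less than \<open>card A\<close>, so they are equal, and the claim compares their top coefficients. Stated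
  without division: in the application the weights are smaller Vandermonde products, with signs.
\<close>

lemma lagrange_top_coeff:
  fixes x :: "'i \<Rightarrow> 'r::idom"
  assumes fin: "finite A" and inj: "inj_on x A" and deg: "Polynomial.degree h < card A"
    and w: "\<And>a. a \<in> A \<Longrightarrow> w a * (\<Prod>b\<in>A - {a}. x a - x b) = V"
  shows "(\<Sum>a\<in>A. w a * poly h (x a)) = V * Polynomial.coeff h (card A - 1)"
proof -
  define L where "L = (\<lambda>a. \<Prod>b\<in>A - {a}. [:- x b, 1:])"
  define Q where "Q = (\<Sum>a\<in>A. Polynomial.smult (w a * poly h (x a)) (L a)) - Polynomial.smult V h"
  have degL: "Polynomial.degree (L a) = card A - 1" if "a \<in> A" for a
    unfolding L_def using that by (subst degree_prod_eq_sum_degree) (auto simp: card_Diff_singleton)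
  have topL: "Polynomial.coeff (L a) (card A - 1) = 1" if "a \<in> A" for a
  proof -
    have "lead_coeff (L a) = 1" unfolding L_def lead_coeff_prod by simp
    thus ?thesis by (simp only: degL[OF that])
  qed
  have "poly Q (x c) = 0" if c: "c \<in> A" for c
  proof -
    have "poly (L a) (x c) = 0" if "a \<in> A - {c}" for a
      unfolding L_def poly_prod using c that fin by (intro prod_zero) auto
    hence "(\<Sum>a\<in>A - {c}. w a * poly h (x a) * poly (L a) (x c)) = 0" by simp
    moreover have "poly (L c) (x c) = (\<Prod>b\<in>A - {c}. x c - x b)" by (simp add: L_def poly_prod)
    ultimately have "(\<Sum>a\<in>A. w a * poly h (x a) * poly (L a) (x c)) = V * poly h (x c)"
      unfolding sum.remove[OF fin c] w[OF c, symmetric] by (simp add: mult_ac)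
    thus ?thesis by (simp add: Q_def poly_sum)
  qed
  hence "x ` A \<subseteq> {z. poly Q z = 0}" by blast
  moreover have "Polynomial.degree Q < card A"
  proof -
    have "Polynomial.degree Q \<le> card A - 1"
      unfolding Q_def using deg degL
      by (intro degree_diff_le degree_sum_le fin order.trans[OF degree_smult_le]) auto
    thus ?thesis using deg by simp
  qed
  ultimately have "Q = 0"
    using card_poly_roots_bound[of Q] poly_roots_finite[of Q] card_image[OF inj]
    by (metis card_mono leD order.trans)
  hence "0 = Polynomial.coeff Q (card A - 1)" by simp
  also have "\<dots> = (\<Sum>a\<in>A. w a * poly h (x a)) - V * Polynomial.coeff h (card A - 1)"
  proof -
    have "(\<Sum>a\<in>A. w a * poly h (x a) * Polynomial.coeff (L a) (card A - 1)) = (\<Sum>a\<in>A. w a * poly h (x a))"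
      by (rule sum.cong) (simp_all only: topL mult_1_right)
    thus ?thesis unfolding Q_def by (simp add: coeff_sum)
  qed
  finally show ?thesis by simp
qed

definition index_pairs :: "nat set \<Rightarrow> (nat \<times> nat) set" where
  "index_pairs S = {(i, j). i \<in> S \<and> j \<in> S \<and> i < j}"

text \<open>
  The family \<open>x\<close> is left open in order to cover both a set of variables and a column of a tableau,
  indexed by its rows.
\<close>

definition vandermonde :: "(nat \<Rightarrow> 'r::comm_ring_1) \<Rightarrow> nat set \<Rightarrow> 'r" where
  "vandermonde x S = (\<Prod>(i, j)\<in>index_pairs S. x i - x j)"

text \<open>
  Specht ideals do not see the order of the entries of a column.
\<close>

definition eq_up_to_sign :: "'r::comm_ring_1 \<Rightarrow> 'r \<Rightarrow> bool" where
  "eq_up_to_sign p q \<longleftrightarrow> p = q \<or> p = - q"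

lemma eq_up_to_sign_refl [simp]: "eq_up_to_sign p p"
  by (simp add: eq_up_to_sign_def)

lemma eq_up_to_sign_sym: "eq_up_to_sign p q \<Longrightarrow> eq_up_to_sign q p"
  by (auto simp: eq_up_to_sign_def)

lemma eq_up_to_sign_trans: "eq_up_to_sign p q \<Longrightarrow> eq_up_to_sign q r \<Longrightarrow> eq_up_to_sign p r"
  by (auto simp: eq_up_to_sign_def)

lemma eq_up_to_sign_mult: "eq_up_to_sign p q \<Longrightarrow> eq_up_to_sign p' q' \<Longrightarrow> eq_up_to_sign (p * p') (q * q')"
  by (auto simp: eq_up_to_sign_def)

lemma eq_up_to_sign_prod: "(\<And>i. i \<in> A \<Longrightarrow> eq_up_to_sign (f i) (g i)) \<Longrightarrow> eq_up_to_sign (prod f A) (prod g A)"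
  by (induction A rule: infinite_finite_induct) (auto intro: eq_up_to_sign_mult)

lemma finite_index_pairs [simp]: "finite S \<Longrightarrow> finite (index_pairs S)"
  by (rule finite_subset[of _ "S \<times> S"]) (auto simp: index_pairs_def)

lemma vandermonde_insert:
  assumes "finite S" "a \<notin> S"
  shows "eq_up_to_sign (vandermonde x (insert a S)) (vandermonde x S * (\<Prod>b\<in>S. x a - x b))"
proof -
  \<comment> \<open>the factors with \<open>b < a\<close> carry the opposite sign\<close>
  let ?L = "{b \<in> S. b < a}" and ?R = "{b \<in> S. a < b}"
  have pairs: "index_pairs (insert a S) = index_pairs S \<union> ((\<lambda>b. (b, a)) ` ?L \<union> Pair a ` ?R)"
    using assms(2) by (auto simp: index_pairs_def)
  have "vandermonde x (insert a S) = vandermonde x S *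
      ((\<Prod>(i, j)\<in>(\<lambda>b. (b, a)) ` ?L. x i - x j) * (\<Prod>(i, j)\<in>Pair a ` ?R. x i - x j))"
    unfolding vandermonde_def pairs using assms
    by (subst prod.union_disjoint, simp, simp, force simp: index_pairs_def)
      (subst prod.union_disjoint, simp, simp, force, simp)
  also have "(\<Prod>(i, j)\<in>(\<lambda>b. (b, a)) ` ?L. x i - x j) = (\<Prod>b\<in>?L. x b - x a)"
    by (subst prod.reindex) (auto simp: inj_on_def)
  also have "(\<Prod>(i, j)\<in>Pair a ` ?R. x i - x j) = (\<Prod>b\<in>?R. x a - x b)"
    by (subst prod.reindex) (auto simp: inj_on_def)
  finally have 1: "vandermonde x (insert a S) =
    vandermonde x S * ((\<Prod>b\<in>?L. x b - x a) * (\<Prod>b\<in>?R. x a - x b))" .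
  have "b < a \<or> a < b" if "b \<in> S" for b using that assms(2) by (metis linorder_neqE_nat)
  hence "S = ?L \<union> ?R" by blast
  hence "(\<Prod>b\<in>S. x a - x b) = (\<Prod>b\<in>?L \<union> ?R. x a - x b)" by simp
  also have "\<dots> = (\<Prod>b\<in>?L. x a - x b) * (\<Prod>b\<in>?R. x a - x b)"
    using assms(1) by (intro prod.union_disjoint) auto
  finally have 2: "(\<Prod>b\<in>S. x a - x b) = (\<Prod>b\<in>?L. x a - x b) * (\<Prod>b\<in>?R. x a - x b)" .
  have "eq_up_to_sign (\<Prod>b\<in>?L. x b - x a) (\<Prod>b\<in>?L. x a - x b)"
    by (rule eq_up_to_sign_prod) (simp add: eq_up_to_sign_def)
  thus ?thesis unfolding 1 2 by (intro eq_up_to_sign_mult) simp_all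
qed

lemma vandermonde_image:
  assumes "finite S" "inj_on f S"
  shows "eq_up_to_sign (vandermonde (\<lambda>i. x (f i)) S) (vandermonde x (f ` S))"
  using assms
proof (induction S rule: finite_induct)
  case empty
  show ?case by (simp add: vandermonde_def index_pairs_def)
next
  case (insert a S)
  have "f a \<notin> f ` S" "inj_on f S" using insert by auto
  hence "eq_up_to_sign (vandermonde x (f ` insert a S)) (vandermonde x (f ` S) * (\<Prod>b\<in>f ` S. x (f a) - x b))"
    using vandermonde_insert[of "f ` S" "f a" x] insert.hyps by simp
  also have "(\<Prod>b\<in>f ` S. x (f a) - x b) = (\<Prod>b\<in>S. x (f a) - x (f b))"
    by (subst prod.reindex) (use \<open>inj_on f S\<close> in auto)
  finally have 1: "eq_up_to_sign (vandermonde x (f ` insert a S))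
    (vandermonde x (f ` S) * (\<Prod>b\<in>S. x (f a) - x (f b)))" .
  have "eq_up_to_sign (vandermonde (\<lambda>i. x (f i)) (insert a S))
      (vandermonde (\<lambda>i. x (f i)) S * (\<Prod>b\<in>S. x (f a) - x (f b)))"
    by (rule vandermonde_insert[OF insert.hyps])
  moreover have "eq_up_to_sign (vandermonde (\<lambda>i. x (f i)) S * (\<Prod>b\<in>S. x (f a) - x (f b)))
     (vandermonde x (f ` S) * (\<Prod>b\<in>S. x (f a) - x (f b)))"
    by (intro eq_up_to_sign_mult insert.IH \<open>inj_on f S\<close>) simp
  ultimately show ?case using eq_up_to_sign_sym[OF 1] eq_up_to_sign_trans by blast
qed

lemma inj_X: "inj (X :: nat \<Rightarrow> 'k::field mpoly)"
proof (rule injI)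
  fix i j assume "(X i :: 'k mpoly) = X j"
  hence "Poly_Mapping.keys (X i :: 'k mpoly) = Poly_Mapping.keys (X j :: 'k mpoly)" by simp
  hence "Poly_Mapping.single i (1::nat) = Poly_Mapping.single j 1" by (simp add: X_def)
  hence "Poly_Mapping.keys (Poly_Mapping.single i (1::nat)) = Poly_Mapping.keys (Poly_Mapping.single j (1::nat))" by simp
  thus "i = j" by simp
qed

text \<open>
  Apply \<open>lagrange_top_coeff\<close> to the monic polynomial \<open>h = z ^ r * (\<Prod>b\<in>B. z - X b)\<close> of degree
  \<open>card A - 1\<close>: the factor \<open>poly h (X a)\<close> completes the Vandermonde product of \<open>B\<close> to that of
  \<open>insert a B\<close>, and it is \<open>0\<close> for \<open>a \<in> B\<close>. So no term repeats an entry in a column, which keeps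
  the copies of \<open>1\<close> in distinct columns.
\<close>

lemma vandermonde_exchange:
  assumes fin: "finite A" "finite B" and card: "card B < card A"
  shows "\<exists>c. (\<forall>a\<in>A - B. eq_up_to_sign (c a) (X a ^ (card A - 1 - card B))) \<and>
    vandermonde X A * vandermonde X B =
      (\<Sum>a\<in>A - B. c a * (vandermonde X (A - {a}) * vandermonde X (insert a B) :: 'k::field mpoly))"
proof -
  let ?V = "vandermonde X :: nat set \<Rightarrow> 'k mpoly" and ?x = "X :: nat \<Rightarrow> 'k mpoly"
  have "\<exists>s. eq_up_to_sign s 1 \<and> s * ?V (A - {a}) * (\<Prod>b\<in>A - {a}. ?x a - ?x b) = ?V A" if "a \<in> A" for a
    using vandermonde_insert[of "A - {a}" a ?x] fin(1) insert_Diff[OF that]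
    by (intro exI[of _ "if ?V A = ?V (A - {a}) * (\<Prod>b\<in>A - {a}. ?x a - ?x b) then 1 else - 1"])
      (auto simp: eq_up_to_sign_def)
  then obtain s where s: "\<And>a. a \<in> A \<Longrightarrow> eq_up_to_sign (s a) 1"
    "\<And>a. a \<in> A \<Longrightarrow> s a * ?V (A - {a}) * (\<Prod>b\<in>A - {a}. ?x a - ?x b) = ?V A" by metis
  have "\<exists>s. eq_up_to_sign s 1 \<and> ?V B * (\<Prod>b\<in>B. ?x a - ?x b) = s * ?V (insert a B)" if "a \<notin> B" for a
    using vandermonde_insert[of B a ?x] fin(2) that
    by (intro exI[of _ "if ?V B * (\<Prod>b\<in>B. ?x a - ?x b) = ?V (insert a B) then 1 else - 1"])
      (auto simp: eq_up_to_sign_def)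
  then obtain s' where s': "\<And>a. a \<notin> B \<Longrightarrow> eq_up_to_sign (s' a) 1"
    "\<And>a. a \<notin> B \<Longrightarrow> ?V B * (\<Prod>b\<in>B. ?x a - ?x b) = s' a * ?V (insert a B)" by metis
  let ?r = "card A - 1 - card B"
  define h where "h = Polynomial.monom 1 ?r * (\<Prod>b\<in>B. [:- ?x b, 1:])"
  have "Polynomial.degree (\<Prod>b\<in>B. [:- ?x b, 1:]) = card B"
    by (subst degree_prod_eq_sum_degree) auto
  moreover have nz: "(\<Prod>b\<in>B. [:- ?x b, 1:]) \<noteq> 0" using fin(2) by simp
  ultimately have deg: "Polynomial.degree h = card A - 1"
    unfolding h_def using card by (subst degree_mult_eq) (auto simp: degree_monom_eq)
  have "lead_coeff h = 1" unfolding h_def lead_coeff_mult lead_coeff_prod by (simp add: degree_monom_eq)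
  hence top: "Polynomial.coeff h (card A - 1) = 1" by (simp only: deg)
  have ph: "poly h (?x a) = ?x a ^ ?r * (\<Prod>b\<in>B. ?x a - ?x b)" for a
    by (simp add: h_def poly_monom poly_prod)
  have inj: "inj_on ?x A" by (rule inj_on_subset[OF inj_X]) simp
  have VA: "?V A = (\<Sum>a\<in>A. s a * ?V (A - {a}) * poly h (?x a))"
    using lagrange_top_coeff[OF fin(1), of ?x h "\<lambda>a. s a * ?V (A - {a})" "?V A"] s(2) deg top card inj by simp
  have "?V A * ?V B = (\<Sum>a\<in>A. s a * ?V (A - {a}) * poly h (?x a)) * ?V B" using VA by simp
  also have "\<dots> = (\<Sum>a\<in>A. s a * ?x a ^ ?r * ?V (A - {a}) * (?V B * (\<Prod>b\<in>B. ?x a - ?x b)))"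
    unfolding sum_distrib_right ph by (intro sum.cong) (simp_all only: mult_ac)
  also have "\<dots> = (\<Sum>a\<in>A - B. s a * ?x a ^ ?r * ?V (A - {a}) * (?V B * (\<Prod>b\<in>B. ?x a - ?x b)))"
    using fin by (intro sum.mono_neutral_right) (auto intro!: prod_zero)
  also have "\<dots> = (\<Sum>a\<in>A - B. (s a * s' a * ?x a ^ ?r) * (?V (A - {a}) * ?V (insert a B)))"
    by (intro sum.cong) (auto simp: s' mult_ac)
  finally have "?V A * ?V B = (\<Sum>a\<in>A - B. (s a * s' a * ?x a ^ ?r) * (?V (A - {a}) * ?V (insert a B)))" .
  moreover have "eq_up_to_sign (s a * s' a * ?x a ^ ?r) (?x a ^ ?r)" if "a \<in> A - B" for a
    using s(1)[of a] s'(1)[of a] that by (auto simp: eq_up_to_sign_def)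
  ultimately show ?thesis by (intro exI[of _ "\<lambda>a. s a * s' a * ?x a ^ ?r"]) blast
qed

section \<open>Tableaux as families of columns\<close>

definition column :: "nat list \<Rightarrow> nat \<Rightarrow> nat set" where
  "column lam j = {i. (i, j) \<in> diagram lam}"

lemma finite_column [simp]: "finite (column lam j)"
  by (simp add: column_def)

lemma card_column_antimono: "j \<le> k \<Longrightarrow> card (column lam k) \<le> card (column lam j)"
  by (rule card_mono, simp) (auto simp: column_def diagram_iff)

lemma sum_column_plus_excess:
  "(\<Sum>j<t. card (column lam j)) + excess t lam = sum_list lam"
proof -
  have "{c \<in> diagram lam. snd c < t} = prod.swap ` (SIGMA j:{..<t}. column lam j)"
    by (auto simp: column_def image_iff)
  hence "card {c \<in> diagram lam. snd c < t} = (\<Sum>j<t. card (column lam j))"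
    by (simp add: card_image inj_on_def)
  moreover have "card {c \<in> diagram lam. snd c < t} + card {c \<in> diagram lam. t \<le> snd c} = card (diagram lam)"
    by (subst card_Un_disjoint[symmetric]) (auto intro!: arg_cong[of _ _ card])
  moreover have "card (diagram lam) = sum_list lam" using excess_eq_card[of 0 lam] by simp
  ultimately show ?thesis using excess_eq_card[of t lam] by simp
qed

lemma diagram_eq_columns:
  assumes "lam \<in> partitions m"
  shows "diagram lam = prod.swap ` (SIGMA j:{..<m}. column lam j)"
proof -
  have "j < m" if "(i, j) \<in> diagram lam" for i j
  proof -
    have "j < part lam i" "i < length lam" using that by (auto simp: diagram_def part_def)
    moreover have "part lam i \<le> sum_list lam" using \<open>i < length lam\<close>
      by (simp add: part_def member_le_sum_list)
    ultimately show ?thesis using assms by (simp add: partitions_def)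
  qed
  thus ?thesis by (auto simp: column_def image_iff)
qed

lemma specht_poly_eq_prod:
  assumes "lam \<in> partitions m"
  shows "(specht_poly lam T :: 'k::field mpoly) = (\<Prod>j<m. vandermonde (\<lambda>i. X (T (i, j))) (column lam j))"
proof -
  have "(column_product lam T j :: 'k mpoly) = vandermonde (\<lambda>i. X (T (i, j))) (column lam j)" for j
    unfolding column_product_def vandermonde_def index_pairs_def column_def
    by (rule prod.cong) auto
  hence "(specht_poly lam T :: 'k mpoly) = (\<Prod>j\<in>snd ` diagram lam. vandermonde (\<lambda>i. X (T (i, j))) (column lam j))"
    by (simp add: specht_poly_def)
  also have "\<dots> = (\<Prod>j<m. vandermonde (\<lambda>i. X (T (i, j))) (column lam j))"
  proof (rule prod.mono_neutral_left)
    show "snd ` diagram lam \<subseteq> {..<m}" using diagram_eq_columns[OF assms] by auto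
    show "\<forall>j\<in>{..<m} - snd ` diagram lam. vandermonde (\<lambda>i. X (T (i, j))) (column lam j) = 1"
    proof
      fix j assume "j \<in> {..<m} - snd ` diagram lam"
      hence "column lam j = {}" by (force simp: column_def)
      thus "vandermonde (\<lambda>i. X (T (i, j))) (column lam j) = 1"
        by (simp add: vandermonde_def index_pairs_def)
    qed
  qed simp
  finally show ?thesis .
qed

lemma mset_content_columns:
  assumes "lam \<in> partitions m"
  shows "image_mset T (mset_set (diagram lam)) =
    (\<Sum>j<m. image_mset (\<lambda>i. T (i, j)) (mset_set (column lam j)))"
proof -
  have sgl: "image_mset f (mset_set S) = (\<Sum>c\<in>S. {#f c#})" if "finite S" for f :: "'b \<Rightarrow> 'c" and S
    using that by (induction S rule: finite_induct) auto
  have "image_mset T (mset_set (diagram lam)) = (\<Sum>c\<in>diagram lam. {#T c#})"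
    by (rule sgl) simp
  also have "\<dots> = (\<Sum>(j, i)\<in>(SIGMA j:{..<m}. column lam j). {#T (i, j)#})"
    unfolding diagram_eq_columns[OF assms] by (subst sum.reindex) (auto simp: inj_on_def intro!: sum.cong)
  also have "\<dots> = (\<Sum>j<m. \<Sum>i\<in>column lam j. {#T (i, j)#})"
    by (rule sum.Sigma[symmetric]) auto
  also have "\<dots> = (\<Sum>j<m. image_mset (\<lambda>i. T (i, j)) (mset_set (column lam j)))"
    by (intro sum.cong refl sgl[symmetric]) simp
  finally show ?thesis .
qed

text \<open>
  A repeated \<open>1\<close> is excluded by the definition of tableaux, and every other entry occurs only once.
\<close>

lemma tableau_inj_on_column:
  assumes T: "T \<in> tableaux n l lam"
  shows "inj_on (\<lambda>i. T (i, j)) (column lam j)"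
proof (rule inj_onI)
  fix i i' assume i: "i \<in> column lam j" "i' \<in> column lam j" "T (i, j) = T (i', j)"
  have D: "(i, j) \<in> diagram lam" "(i', j) \<in> diagram lam" using i by (auto simp: column_def)
  show "i = i'"
  proof (cases "T (i, j) = 1")
    case True
    thus ?thesis using tableauxD(3)[OF T D] i(3) by simp
  next
    case False
    let ?S = "{c \<in> diagram lam. T c = T (i, j)}"
    have "card ?S = count (replicate_mset l 1 + mset_set {2..n}) (T (i, j))"
      using count_image_mset_set[of "diagram lam" T "T (i, j)"] by (simp only: finite_diagram tableauxD(2)[OF T])
    also have "\<dots> \<le> 1" using False by (simp add: count_mset_set')
    finally have le: "card ?S \<le> Suc 0" by simp
    have "finite ?S" by simp
    note all = iffD1[OF card_le_Suc0_iff_eq[OF this] le]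
    have "(i, j) \<in> ?S" "(i', j) \<in> ?S" using D i(3) by simp_all
    hence "(i, j) = (i', j)" using all by blast
    thus ?thesis by simp
  qed
qed

text \<open>
  The contents of the columns of a filling whose column lengths need not be decreasing. There
  are as many columns as entries, enough for every shape; some of them may be empty.
\<close>

definition column_family :: "nat \<Rightarrow> nat \<Rightarrow> (nat \<Rightarrow> nat set) \<Rightarrow> bool" where
  "column_family n l C \<longleftrightarrow> (\<forall>j. finite (C j)) \<and>
     (\<Sum>j<n + l - 1. mset_set (C j)) = replicate_mset l 1 + mset_set {2..n}"

lemma column_family_finite: "column_family n l C \<Longrightarrow> finite (C i)"
  by (simp add: column_family_def)

lemma column_family_entries:
  assumes "column_family n l C" "1 \<le> n" "j < n + l - 1"
  shows "C j \<subseteq> {1..n}"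
proof
  fix v assume "v \<in> C j"
  hence "v \<in># mset_set (C j)" using assms(1) by (simp add: column_family_def)
  hence "v \<in># (\<Sum>j<n + l - 1. mset_set (C j))"
    using assms(3) unfolding set_mset_sum[OF finite_lessThan] by blast
  hence "v \<in># replicate_mset l 1 + mset_set {2..n}" using assms(1) by (simp add: column_family_def)
  thus "v \<in> {1..n}" using assms(2) by (auto simp: in_replicate_mset split: if_splits)
qed

lemma tableau_column_family:
  assumes lam: "lam \<in> partitions (n + l - 1)" and T: "T \<in> tableaux n l lam"
  defines "C \<equiv> \<lambda>j. (\<lambda>i. T (i, j)) ` column lam j"
  shows "column_family n l C" "\<And>j. card (C j) = card (column lam j)"
    "eq_up_to_sign (specht_poly lam T) (\<Prod>j<n + l - 1. vandermonde X (C j) :: 'k::field mpoly)"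
proof -
  note inj = tableau_inj_on_column[OF T]
  have "mset_set (C j) = image_mset (\<lambda>i. T (i, j)) (mset_set (column lam j))" for j
    unfolding C_def using image_mset_mset_set[OF inj[of j]] by simp
  thus "column_family n l C"
    unfolding column_family_def using mset_content_columns[OF lam, of T] tableauxD(2)[OF T]
    by (simp add: C_def)
  show "\<And>j. card (C j) = card (column lam j)" unfolding C_def by (rule card_image) (rule inj)
  show "eq_up_to_sign (specht_poly lam T) (\<Prod>j<n + l - 1. vandermonde X (C j) :: 'k::field mpoly)"
    unfolding specht_poly_eq_prod[OF lam] C_def
    by (intro eq_up_to_sign_prod vandermonde_image inj) simp
qed

text \<open>
  Within a column the order of the entries affects the sign only, so any bijection onto the
  squares of the column will do.
\<close>

lemma column_family_tableau:
  assumes n: "1 \<le> n" and lam: "lam \<in> partitions (n + l - 1)" and C: "column_family n l C"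
    and card: "\<And>j. j < n + l - 1 \<Longrightarrow> card (C j) = card (column lam j)"
  shows "\<exists>T\<in>tableaux n l lam. eq_up_to_sign (\<Prod>j<n + l - 1. vandermonde X (C j) :: 'k::field mpoly) (specht_poly lam T)"
proof -
  let ?m = "n + l - 1"
  have "\<exists>f. bij_betw f (column lam j) (C j)" if "j < ?m" for j
    using C card[OF that] by (intro finite_same_card_bij) (auto simp: column_family_def)
  then obtain f where f: "\<And>j. j < ?m \<Longrightarrow> bij_betw (f j) (column lam j) (C j)" by metis
  define T where "T = restrict (\<lambda>(i, j). f j i) (diagram lam)"
  have Tf: "T (i, j) = f j i" if "i \<in> column lam j" for i j
    using that by (simp add: T_def column_def)
  have bij: "bij_betw (\<lambda>i. T (i, j)) (column lam j) (C j)" if "j < ?m" for j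
    using f[OF that] bij_betw_cong[of "column lam j" "f j" "\<lambda>i. T (i, j)"] Tf by simp
  have "image_mset (\<lambda>i. T (i, j)) (mset_set (column lam j)) = mset_set (C j)" if "j < ?m" for j
    using image_mset_mset_set[of "\<lambda>i. T (i, j)" "column lam j"] bij[OF that] by (simp add: bij_betw_def)
  hence "image_mset T (mset_set (diagram lam)) = replicate_mset l 1 + mset_set {2..n}"
    unfolding mset_content_columns[OF lam] using C by (simp add: column_family_def)
  moreover have "i = i'" if "(i, j) \<in> diagram lam" "(i', j) \<in> diagram lam" "T (i, j) = 1" "T (i', j) = 1" for i i' j
  proof -
    have "j < ?m" using that(1) diagram_eq_columns[OF lam] by auto
    thus ?thesis using bij[of j] that by (auto simp: bij_betw_def inj_on_def column_def)
  qed
  moreover have "T \<in> extensional (diagram lam)" by (simp add: T_def)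
  ultimately have T: "T \<in> tableaux n l lam" unfolding tableaux_def by blast
  have "eq_up_to_sign (\<Prod>j<?m. vandermonde (\<lambda>i. X (T (i, j))) (column lam j) :: 'k mpoly) (\<Prod>j<?m. vandermonde X (C j))"
  proof (rule eq_up_to_sign_prod)
    fix j assume "j \<in> {..<?m}"
    hence "inj_on (\<lambda>i. T (i, j)) (column lam j)" "(\<lambda>i. T (i, j)) ` column lam j = C j"
      using bij[of j] by (auto simp: bij_betw_def)
    thus "eq_up_to_sign (vandermonde (\<lambda>i. X (T (i, j))) (column lam j) :: 'k mpoly) (vandermonde X (C j))"
      using vandermonde_image[of "column lam j" "\<lambda>i. T (i, j)" X] by simp
  qed
  thus ?thesis using T eq_up_to_sign_sym unfolding specht_poly_eq_prod[OF lam] by blast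
qed

section \<open>Specht ideals along the dominance order\<close>

lemma ideal_sign: "ideal I (poly_ring n) \<Longrightarrow> eq_up_to_sign p q \<Longrightarrow> q \<in> I \<Longrightarrow> p \<in> I"
  using ideal_uminus[of I n q] by (auto simp: eq_up_to_sign_def)

definition move_entry :: "nat \<Rightarrow> nat \<Rightarrow> nat \<Rightarrow> (nat \<Rightarrow> nat set) \<Rightarrow> nat \<Rightarrow> nat set" where
  "move_entry j k a C = C(j := C j - {a}, k := insert a (C k))"

lemma column_family_move_entry:
  assumes C: "column_family n l C" and jk: "j < k" "k < n + l - 1" and a: "a \<in> C j - C k"
  shows "column_family n l (move_entry j k a C)"
proof -
  note finite_C = column_family_finite[OF C]
  let ?M = "n + l - 1"
  have split: "(\<Sum>i<?M. g i) = g j + (g k + (\<Sum>i\<in>{..<?M} - {j} - {k}. g i))" for g :: "nat \<Rightarrow> nat multiset"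
    using jk sum.remove[of "{..<?M}" j g] sum.remove[of "{..<?M} - {j}" k g] by simp
  have "mset_set (insert a (C k)) = add_mset a (mset_set (C k))" using a finite_C by simp
  moreover have "mset_set (C j) = add_mset a (mset_set (C j - {a}))"
    using a finite_C by (metis DiffD1 mset_set.remove)
  moreover have "(\<Sum>i\<in>{..<?M} - {j} - {k}. mset_set (move_entry j k a C i)) = (\<Sum>i\<in>{..<?M} - {j} - {k}. mset_set (C i))"
    by (rule sum.cong) (auto simp: move_entry_def)
  ultimately have "(\<Sum>i<?M. mset_set (move_entry j k a C i)) = (\<Sum>i<?M. mset_set (C i))"
    unfolding split using jk by (simp add: move_entry_def)
  thus ?thesis using C by (simp add: column_family_def move_entry_def)
qed

lemma sum_card_move_entry:
  assumes finite_C: "\<And>i. finite (C i)" and jk: "j < k" and a: "a \<in> C j - C k"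
  shows "(\<Sum>i<t. card (move_entry j k a C i)) + (if j < t \<and> t \<le> k then 1 else 0) = (\<Sum>i<t. card (C i))"
proof (induction t)
  case (Suc t)
  have "card (C j) = Suc (card (C j - {a}))" using a finite_C by (metis DiffD1 card.remove)
  moreover have "card (insert a (C k)) = Suc (card (C k))" using a finite_C by simp
  ultimately have "card (move_entry j k a C t) + (if t = j then 1 else 0) = card (C t) + (if t = k then 1 else 0)"
    using jk by (auto simp: move_entry_def)
  thus ?case using Suc.IH jk by (auto split: if_splits)
qed simp

text \<open>
  As long as the column lengths differ from those of \<open>lam\<close>, some entry can be moved to the right
  without losing the inequalities: let \<open>u\<close> be the first point where the partial sums differ and
  \<open>v\<close> the next one where they agree again. Column \<open>u - 1\<close> is longer than that of \<open>lam\<close> and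
  column \<open>v - 1\<close> shorter, hence the first is longer than the second, and the inequality is strict
  at all points between. The exchange identity expresses the product through the families after
  such a move, whose partial sums are smaller. Column lengths may lose their order on the way.
\<close>

lemma column_family_prod_in_specht_ideal:
  fixes n l :: nat
  assumes n: "1 \<le> n" and lam: "lam \<in> partitions (n + l - 1)" and C: "column_family n l C"
    and le: "\<And>t. t \<le> n + l - 1 \<Longrightarrow> (\<Sum>i<t. card (column lam i)) \<le> (\<Sum>i<t. card (C i))"
  shows "(\<Prod>i<n + l - 1. vandermonde X (C i)) \<in> (specht_ideal n l lam :: 'k::field mpoly set)"
  using C le
proof (induction "\<Sum>t\<le>n + l - 1. (\<Sum>i<t. card (C i))" arbitrary: C rule: less_induct)
  case less
  let ?M = "n + l - 1" and ?I = "specht_ideal n l lam :: 'k mpoly set"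
  let ?c = "\<lambda>i. card (C i)" and ?d = "\<lambda>i. card (column lam i)"
  have I: "ideal ?I (poly_ring n)" by (rule ideal_specht_ideal[OF n])
  note Cfin = column_family_finite[OF less.prems(1)]
  have total: "(\<Sum>i<?M. ?c i) = ?M"
  proof -
    have "(\<Sum>i<?M. ?c i) = size (\<Sum>j<?M. mset_set (C j))" by (simp add: size_multiset_sum)
    also have "\<dots> = size (replicate_mset l 1 + mset_set {2..n})" 
      using less.prems(1) by (simp add: column_family_def)
    also have "\<dots> = ?M" using n by simp
    finally show ?thesis .
  qed
  have totald: "(\<Sum>i<?M. ?d i) \<ge> ?M"
    using sum_column_plus_excess[of lam ?M] lam excess_eq_0[of lam ?M] member_le_sum_list[of _ lam]
    by (simp add: partitions_def)
  show ?case
  proof (cases "\<forall>t\<le>?M. (\<Sum>i<t. ?c i) \<le> (\<Sum>i<t. ?d i)")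
    case True
    have "card (C i) = card (column lam i)" if "i < ?M" for i
    proof -
      have "(\<Sum>i<t. ?c i) = (\<Sum>i<t. ?d i)" if "t \<le> ?M" for t
        using True less.prems(2)[of t] that by (simp add: le_antisym)
      from this[of i] this[of "Suc i"] that show ?thesis by simp
    qed
    then obtain T where T: "T \<in> tableaux n l lam"
      "eq_up_to_sign (\<Prod>j<?M. vandermonde X (C j) :: 'k mpoly) (specht_poly lam T)"
      using column_family_tableau[OF n lam less.prems(1)] by blast
    from specht_poly_in_specht_ideal[OF n T(1)] show ?thesis by (rule ideal_sign[OF I T(2)])
  next
    case False
    \<comment> \<open>points at which the inequality between the partial sums is strict\<close>
    define gap where "gap t \<longleftrightarrow> t \<le> ?M \<and> (\<Sum>i<t. ?d i) < (\<Sum>i<t. ?c i)" for t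
    have "\<exists>t. gap t" using False by (auto simp: gap_def not_le)
    define u where "u = (LEAST t. gap t)"
    have u: "gap u" "\<And>t. t < u \<Longrightarrow> \<not> gap t"
      unfolding u_def by (rule LeastI_ex[OF \<open>\<exists>t. gap t\<close>]) (rule not_less_Least)
    have ex: "\<exists>t. u \<le> t \<and> \<not> gap t" using total totald u(1) by (intro exI[of _ ?M]) (auto simp: gap_def)
    define v where "v = (LEAST t. u \<le> t \<and> \<not> gap t)"
    have "u \<le> v \<and> \<not> gap v" unfolding v_def by (rule LeastI_ex[OF ex])
    hence v: "u \<le> v" "\<not> gap v" by blast+
    have v_min: "gap t" if "u \<le> t" "t < v" for t
      using not_less_Least[OF that(2)[unfolded v_def]] that(1) by blast
    have "\<not> gap 0" by (simp add: gap_def)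
    hence "u \<noteq> 0" using u(1) by (cases u) simp_all
    then obtain j where j: "u = Suc j" by (cases u) auto
    have "v \<noteq> u" using u(1) v(2) by auto
    then obtain k where k: "v = Suc k" "j < k" using v(1) j by (cases v) auto
    have "gap k" using v_min[of k] k j by simp
    moreover have "k \<noteq> ?M" using \<open>gap k\<close> total totald by (auto simp: gap_def)
    ultimately have kM: "k < ?M" by (simp add: gap_def)
    have cj: "?d j < ?c j"
      using u(1) u(2)[of j] less.prems(2)[of j] j by (auto simp: gap_def not_less)
    have ck: "?c k < ?d k"
      using \<open>gap k\<close> v(2) kM k(1) by (auto simp: gap_def not_less)
    have lt: "?c k < ?c j" using cj ck card_column_antimono[of j k lam] k(2) by simp
    obtain s where s: "\<And>a. a \<in> C j - C k \<Longrightarrow> eq_up_to_sign (s a) (X a ^ (?c j - 1 - ?c k) :: 'k mpoly)"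
      "vandermonde X (C j) * vandermonde X (C k) =
        (\<Sum>a\<in>C j - C k. s a * (vandermonde X (C j - {a}) * vandermonde X (insert a (C k)) :: 'k mpoly))"
      using vandermonde_exchange[OF Cfin Cfin lt, where 'k = 'k] by blast
    let ?rest = "\<Prod>i\<in>{..<?M} - {j} - {k}. vandermonde X (C i) :: 'k mpoly"
    have split: "(\<Prod>i<?M. g i) = g j * g k * (\<Prod>i\<in>{..<?M} - {j} - {k}. g i)" for g :: "nat \<Rightarrow> 'k mpoly"
      using k(2) kM prod.remove[of "{..<?M}" j g] prod.remove[of "{..<?M} - {j}" k g] by (simp add: mult.assoc)
    have moved: "s a * (\<Prod>i<?M. vandermonde X (move_entry j k a C i)) \<in> ?I" if a: "a \<in> C j - C k" for a
    proof (rule ideal_mult[OF I])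
      have "a \<in> {1..n}" using column_family_entries[OF less.prems(1) n, of j] k(2) kM a by auto
      hence "X a ^ (?c j - 1 - ?c k) \<in> carrier (poly_ring n :: 'k mpoly ring)"
        by (intro poly_ring_power X_in_poly_ring)
      thus "s a \<in> carrier (poly_ring n)"
        using s(1)[OF a] unfolding eq_up_to_sign_def by (auto intro: poly_ring_uminus)
      note S = sum_card_move_entry[of C, OF Cfin k(2) a]
      show "(\<Prod>i<?M. vandermonde X (move_entry j k a C i)) \<in> ?I"
      proof (rule less.hyps)
        show "column_family n l (move_entry j k a C)"
          by (rule column_family_move_entry[OF less.prems(1) k(2) kM a])
        show "(\<Sum>t\<le>?M. \<Sum>i<t. card (move_entry j k a C i)) < (\<Sum>t\<le>?M. \<Sum>i<t. ?c i)"
        proof (rule sum_strict_mono_ex1)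
          show "\<forall>t\<in>{..?M}. (\<Sum>i<t. card (move_entry j k a C i)) \<le> (\<Sum>i<t. ?c i)"
            using le_add1 S by (intro ballI) (simp only: S[symmetric])
          show "\<exists>t\<in>{..?M}. (\<Sum>i<t. card (move_entry j k a C i)) < (\<Sum>i<t. ?c i)"
            using S[of k] k(2) kM by (intro bexI[of _ k]) auto
        qed simp
        fix t assume t: "t \<le> ?M"
        show "(\<Sum>i<t. ?d i) \<le> (\<Sum>i<t. card (move_entry j k a C i))"
        proof (cases "j < t \<and> t \<le> k")
          case True
          hence "gap t" using v_min[of t] j k(1) by simp
          thus ?thesis using S[of t] True by (simp add: gap_def)
        next
          case False
          hence "(\<Sum>i<t. card (move_entry j k a C i)) = (\<Sum>i<t. ?c i)"
            using S[of t] by (simp only: if_False add_0_right)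
          thus ?thesis using less.prems(2)[OF t] by simp
        qed
      qed
    qed
    have "(\<Prod>i<?M. vandermonde X (C i)) = (\<Sum>a\<in>C j - C k. s a * (\<Prod>i<?M. vandermonde X (move_entry j k a C i)))"
    proof -
      have "(\<Prod>i<?M. vandermonde X (move_entry j k a C i)) =
          vandermonde X (C j - {a}) * vandermonde X (insert a (C k)) * ?rest" for a
      proof -
        have "(\<Prod>i\<in>{..<?M} - {j} - {k}. vandermonde X (move_entry j k a C i)) = ?rest"
          by (rule prod.cong) (auto simp: move_entry_def)
        thus ?thesis unfolding split using k(2) by (simp add: move_entry_def)
      qed
      thus ?thesis unfolding split[of "\<lambda>i. vandermonde X (C i)"] s(2) by (simp add: sum_distrib_right mult.assoc)
    qed
    also have "\<dots> \<in> ?I" by (rule ideal_sum[OF I moved])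
    finally show ?thesis .
  qed
qed

text \<open>
  Dominance says that the partial sums of the column lengths of \<open>mu\<close> are the larger ones.
\<close>

theorem specht_ideal_mono:
  assumes n: "1 \<le> n" and mu: "mu \<in> partitions (n + l - 1)" and lam: "lam \<in> partitions (n + l - 1)"
    and dom: "dominated mu lam"
  shows "(specht_ideal n l mu :: 'k::field mpoly set) \<subseteq> specht_ideal n l lam"
proof -
  note I = ideal_specht_ideal[OF n, of l lam, where 'k = 'k]
  have "specht_poly mu T \<in> (specht_ideal n l lam :: 'k mpoly set)" if T: "T \<in> tableaux n l mu" for T
  proof -
    note F = tableau_column_family[OF mu T]
    have "(\<Sum>i<t. card (column lam i)) \<le> (\<Sum>i<t. card ((\<lambda>r. T (r, i)) ` column mu i))" for t
    proof -
      have "excess t mu \<le> excess t lam" using dom dominated_iff_excess[OF mu lam] by simp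
      thus ?thesis
        using sum_column_plus_excess[of mu t] sum_column_plus_excess[of lam t] mu lam
        unfolding F(2) by (simp add: partitions_def)
    qed
    hence "(\<Prod>j<n + l - 1. vandermonde X ((\<lambda>i. T (i, j)) ` column mu j)) \<in> (specht_ideal n l lam :: 'k mpoly set)"
      by (intro column_family_prod_in_specht_ideal[OF n lam F(1)])
    thus ?thesis by (rule ideal_sign[OF I F(3)])
  qed
  thus ?thesis unfolding specht_ideal_def[of n l mu]
    by (intro genideal_poly_ring(3)[OF specht_gens_carrier[OF n] I]) blast
qed

section \<open>Specht ideals as vanishing ideals\<close>
lemma finite_partitions: "finite (partitions m)"
proof (rule finite_subset)
  show "partitions m \<subseteq> {xs. set xs \<subseteq> {..m} \<and> length xs \<le> m}"
  proof clarify
    fix xs assume xs: "xs \<in> partitions m"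
    hence pos: "\<forall>x\<in>set xs. 0 < x" and sum: "sum_list xs = m" by (simp_all add: partitions_def)
    have "length xs \<le> sum_list xs" using pos by (induction xs) auto
    moreover have "set xs \<subseteq> {..m}" using member_le_sum_list[of _ xs] sum by auto
    ultimately show "set xs \<subseteq> {..m} \<and> length xs \<le> m" using sum by simp
  qed
  show "finite {xs. set xs \<subseteq> {..m} \<and> length xs \<le> m}" by (rule finite_lists_length_le) simp
qed

lemma finite_tableaux: "1 \<le> n \<Longrightarrow> finite (tableaux n l lam)"
proof (rule finite_subset)
  assume n: "1 \<le> n"
  show "tableaux n l lam \<subseteq> PiE (diagram lam) (\<lambda>_. {1..n})"
    using tableau_entries[OF _ _ n] tableauxD(1) by (intro subsetI PiE_I) blast+
  show "finite (PiE (diagram lam) (\<lambda>_. {1..n}))" by (rule finite_PiE) simp_all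
qed

definition standard_specht_polys :: "nat \<Rightarrow> nat \<Rightarrow> nat list set \<Rightarrow> 'k::field mpoly set" where
  "standard_specht_polys n l F = {specht_poly mu T | mu T. mu \<in> F \<and> T \<in> standard_tableaux n l mu}"

lemma finite_standard_specht_polys:
  assumes "1 \<le> n" "F \<subseteq> partitions m"
  shows "finite (standard_specht_polys n l F)"
proof -
  have "standard_specht_polys n l F \<subseteq> (\<Union>mu\<in>F. specht_poly mu ` tableaux n l mu)"
    unfolding standard_specht_polys_def standard_tableaux_def by blast
  moreover have "finite F" using finite_subset[OF assms(2) finite_partitions] .
  ultimately show ?thesis using finite_tableaux[OF assms(1)] by (auto intro: finite_subset)
qed

context
  fixes n l :: nat and F :: "nat list set"
  assumes n: "1 \<le> n" and l: "1 \<le> l" and F: "lower_filter n l F"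
begin

lemma filter_partitions: "mu \<in> F \<Longrightarrow> mu \<in> partitions (n + l - 1)"
  using F by (auto simp: lower_filter_def partitions_ge_def)

text \<open>
  Only the coordinates with index in \<open>{1..n}\<close> matter, so points may be arbitrary functions.
\<close>

lemma vanishing_complement_iff:
  "f \<in> vanishing_ideal n l (partitions_ge n l - F) \<longleftrightarrow>
     f \<in> carrier (poly_ring n) \<and> (\<forall>a. orbit_type n l a \<notin> F \<longrightarrow> eval_mpoly a f = (0 :: 'k::field))"
proof -
  have "eval_mpoly a f = 0"
    if f: "f \<in> carrier (poly_ring n)" "\<forall>a\<in>affine_space n. orbit_type n l a \<in> partitions_ge n l - F \<longrightarrow> eval_mpoly a f = 0"
      and a: "orbit_type n l a \<notin> F" for a :: "nat \<Rightarrow> 'k"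
  proof -
    let ?b = "restrict a {1..n}"
    have "orbit_type n l ?b = orbit_type n l a" by (rule orbit_type_cong[OF n]) simp
    moreover have "?b \<in> affine_space n" by (simp add: affine_space_def)
    ultimately have "eval_mpoly ?b f = 0" using f(2) a orbit_type_partitions_ge[OF n l, of a] by simp
    moreover have "eval_mpoly ?b f = eval_mpoly a f" by (rule eval_cong[OF f(1)]) simp
    ultimately show ?thesis by simp
  qed
  thus ?thesis unfolding vanishing_ideal_def by blast
qed

lemma specht_poly_vanishes:
  assumes mu: "mu \<in> F" and T: "T \<in> tableaux n l mu"
  shows "specht_poly mu T \<in> (vanishing_ideal n l (partitions_ge n l - F) :: 'k::field mpoly set)"
  unfolding vanishing_complement_iff
proof (intro conjI allI impI)
  show "specht_poly mu T \<in> carrier (poly_ring n :: 'k mpoly ring)" by (rule specht_poly_in_poly_ring[OF T n])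
  fix a :: "nat \<Rightarrow> 'k" assume a: "orbit_type n l a \<notin> F"
  have o: "orbit_type n l a \<in> partitions_ge n l" by (rule orbit_type_partitions_ge[OF n l])
  hence "\<not> dominated (orbit_type n l a) mu" using F mu a unfolding lower_filter_def by blast
  hence "\<not> (\<forall>t. excess t (orbit_type n l a) \<le> excess t mu)"
    using dominated_iff_excess[OF _ filter_partitions[OF mu]] o by (simp add: partitions_ge_def)
  thus "eval_mpoly a (specht_poly mu T) = 0" using excess_orbit_type_le[OF T] by blast
qed

lemma standard_specht_polys_vanish:
  "standard_specht_polys n l F \<subseteq> (vanishing_ideal n l (partitions_ge n l - F) :: 'k::field mpoly set)"
  using specht_poly_vanishes unfolding standard_specht_polys_def standard_tableaux_def by blast

lemma standard_specht_leads_divide: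
  assumes "infinite (UNIV :: 'k::field set)"
  shows "leads_divide (standard_specht_polys n l F) (vanishing_ideal n l (partitions_ge n l - F) :: 'k mpoly set)"
  unfolding leads_divide_def
proof (intro ballI allI impI)
  fix f :: "'k mpoly" and m
  assume f: "f \<in> vanishing_ideal n l (partitions_ge n l - F)" and m: "is_lead f m"
  obtain mu T where mu: "mu \<in> F" and T: "T \<in> standard_tableaux n l mu"
    and le: "\<forall>i. Poly_Mapping.lookup (row_weight mu T) i \<le> Poly_Mapping.lookup m i"
    using standard_tableau_below_lead[OF assms l n F _ m] f unfolding vanishing_complement_iff by blast
  have "is_lead (specht_poly mu T :: 'k mpoly) (row_weight mu T)"
    by (rule is_lead_specht_poly[OF filter_partitions[OF mu] T])
  moreover have "(specht_poly mu T :: 'k mpoly) \<in> standard_specht_polys n l F"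
    using mu T unfolding standard_specht_polys_def by blast
  ultimately show "\<exists>g\<in>standard_specht_polys n l F. \<exists>e. is_lead (g :: 'k mpoly) e \<and>
      (\<forall>i. Poly_Mapping.lookup e i \<le> Poly_Mapping.lookup m i)" using le by blast
qed

text \<open>
  Both kinds of ideals in the theorem lie between the ideal of the standard Specht polynomials and
  the vanishing ideal, which coincide.
\<close>

lemma ideal_eq_vanishing:
  fixes I :: "'k::field mpoly set"
  assumes inf: "infinite (UNIV :: 'k set)" and I: "ideal I (poly_ring n)"
    and GI: "standard_specht_polys n l F \<subseteq> I" and IJ: "I \<subseteq> vanishing_ideal n l (partitions_ge n l - F)"
  shows "I = vanishing_ideal n l (partitions_ge n l - F)"
proof (rule antisym[OF IJ])
  have "vanishing_ideal n l (partitions_ge n l - F) \<subseteq> Idl\<^bsub>poly_ring n\<^esub> (standard_specht_polys n l F :: 'k mpoly set)"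
    by (rule leads_divide_imp_subset[OF ideal_vanishing standard_specht_polys_vanish standard_specht_leads_divide[OF inf]])
  also have "\<dots> \<subseteq> I"
    by (rule genideal_poly_ring(3)[OF _ I GI]) (use GI ideal_sub[OF I] in blast)
  finally show "vanishing_ideal n l (partitions_ge n l - F) \<subseteq> I" .
qed

lemma specht_ideal_sub_vanishing:
  assumes "mu \<in> F"
  shows "specht_ideal n l mu \<subseteq> (vanishing_ideal n l (partitions_ge n l - F) :: 'k::field mpoly set)"
  unfolding specht_ideal_def
  by (rule genideal_poly_ring(3)[OF specht_gens_carrier[OF n] ideal_vanishing])
    (use specht_poly_vanishes[OF assms] in blast)

lemma finite_filter: "finite F"
  using finite_subset[OF _ finite_partitions] filter_partitions by blast

lemma ideal_specht_ideal_filter: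
  "ideal (specht_ideal_filter n l F :: 'k::field mpoly set) (poly_ring n)"
proof (rule ideal_poly_ringI)
  note I = ideal_specht_ideal[OF n, where 'k = 'k]
  show "specht_ideal_filter n l F \<subseteq> carrier (poly_ring n :: 'k mpoly ring)"
  proof
    fix p :: "'k mpoly" assume "p \<in> specht_ideal_filter n l F"
    then obtain g where g: "p = sum g F" "\<forall>lam\<in>F. g lam \<in> specht_ideal n l lam"
      unfolding specht_ideal_filter_def by blast
    have "sum g A \<in> carrier (poly_ring n)" if "finite A" "A \<subseteq> F" for A
      using that
    proof (induction A rule: finite_induct)
      case (insert x A)
      have "g x \<in> carrier (poly_ring n)" using g(2) insert.prems ideal_sub[OF I] by blast
      thus ?case using insert by (simp add: poly_ring_add)
    qed (simp add: poly_ring_zero)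
    thus "p \<in> carrier (poly_ring n)" using g(1) finite_filter by blast
  qed
  show "0 \<in> (specht_ideal_filter n l F :: 'k mpoly set)"
    unfolding specht_ideal_filter_def mem_Collect_eq
    by (intro exI[of _ "\<lambda>_. 0"]) (simp add: ideal_zero[OF I])
next
  fix p q :: "'k mpoly" assume "p \<in> specht_ideal_filter n l F" "q \<in> specht_ideal_filter n l F"
  then obtain g h where "p = sum g F" "\<forall>lam\<in>F. g lam \<in> specht_ideal n l lam"
    "q = sum h F" "\<forall>lam\<in>F. h lam \<in> specht_ideal n l lam"
    unfolding specht_ideal_filter_def by blast
  thus "p + q \<in> specht_ideal_filter n l F"
    unfolding specht_ideal_filter_def mem_Collect_eq
    by (intro exI[of _ "\<lambda>lam. g lam + h lam"]) (simp add: sum.distrib ideal_add[OF ideal_specht_ideal[OF n]])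
next
  fix r p :: "'k mpoly" assume r: "r \<in> carrier (poly_ring n)" and "p \<in> specht_ideal_filter n l F"
  then obtain g where "p = sum g F" "\<forall>lam\<in>F. g lam \<in> specht_ideal n l lam"
    unfolding specht_ideal_filter_def by blast
  thus "r * p \<in> specht_ideal_filter n l F"
    unfolding specht_ideal_filter_def mem_Collect_eq
    by (intro exI[of _ "\<lambda>lam. r * g lam"]) (simp add: sum_distrib_left ideal_mult[OF ideal_specht_ideal[OF n] r])
qed

lemma specht_ideal_filter_eq_vanishing:
  assumes inf: "infinite (UNIV :: 'k::field set)"
  shows "(specht_ideal_filter n l F :: 'k mpoly set) = vanishing_ideal n l (partitions_ge n l - F)"
proof (rule ideal_eq_vanishing[OF inf ideal_specht_ideal_filter])
  show "standard_specht_polys n l F \<subseteq> (specht_ideal_filter n l F :: 'k mpoly set)"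
  proof
    fix p :: "'k mpoly" assume "p \<in> standard_specht_polys n l F"
    then obtain mu T where p: "p = specht_poly mu T" "mu \<in> F" "T \<in> tableaux n l mu"
      unfolding standard_specht_polys_def standard_tableaux_def by blast
    let ?g = "\<lambda>lam. if lam = mu then p else 0"
    have "p = sum ?g F" using p(2) finite_filter by simp
    moreover have "p \<in> specht_ideal n l mu"
      unfolding p(1) by (rule specht_poly_in_specht_ideal[OF n p(3)])
    hence "\<forall>lam\<in>F. ?g lam \<in> specht_ideal n l lam"
      using ideal_zero[OF ideal_specht_ideal[OF n, where 'k = 'k]] by simp
    ultimately show "p \<in> specht_ideal_filter n l F"
      unfolding specht_ideal_filter_def by blast
  qed
  show "specht_ideal_filter n l F \<subseteq> (vanishing_ideal n l (partitions_ge n l - F) :: 'k mpoly set)"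
  proof
    fix p :: "'k mpoly" assume "p \<in> specht_ideal_filter n l F"
    then obtain g where g: "p = sum g F" "\<forall>lam\<in>F. g lam \<in> specht_ideal n l lam"
      unfolding specht_ideal_filter_def by blast
    show "p \<in> vanishing_ideal n l (partitions_ge n l - F)"
      unfolding g(1) using g(2) specht_ideal_sub_vanishing
      by (intro ideal_sum[OF ideal_vanishing]) blast
  qed
qed

end

lemma lower_filter_dominated:
  assumes "lam \<in> partitions_ge n l"
  shows "lower_filter n l {mu \<in> partitions_ge n l. dominated mu lam}"
  unfolding lower_filter_def
proof (intro conjI ballI impI)
  fix mu nu
  assume mu: "mu \<in> {mu \<in> partitions_ge n l. dominated mu lam}" and nu: "nu \<in> partitions_ge n l" and "dominated nu mu"
  have p: "lam \<in> partitions (n + l - 1)" "mu \<in> partitions (n + l - 1)" "nu \<in> partitions (n + l - 1)"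
    using assms mu nu by (auto simp: partitions_ge_def)
  have "\<forall>t. excess t nu \<le> excess t mu" "\<forall>t. excess t mu \<le> excess t lam"
    using dominated_iff_excess[OF p(3,2)] dominated_iff_excess[OF p(2,1)] mu \<open>dominated nu mu\<close> by auto
  hence "dominated nu lam" using dominated_iff_excess[OF p(3,1)] order.trans by blast
  thus "nu \<in> {mu \<in> partitions_ge n l. dominated mu lam}" using nu by simp
qed blast

text \<open>
  The standard Specht polynomials of the dominated shapes lie in the ideal of \<open>lam\<close> by
  \<open>specht_ideal_mono\<close>.
\<close>

lemma specht_ideal_eq_vanishing:
  assumes n: "1 \<le> n" and l: "1 \<le> l" and inf: "infinite (UNIV :: 'k::field set)"
    and lam: "lam \<in> partitions_ge n l"
  shows "(specht_ideal n l lam :: 'k mpoly set) =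
    vanishing_ideal n l (partitions_ge n l - {mu \<in> partitions_ge n l. dominated mu lam})"
proof -
  let ?F = "{mu \<in> partitions_ge n l. dominated mu lam}"
  have F: "lower_filter n l ?F" by (rule lower_filter_dominated[OF lam])
  have lamF: "lam \<in> ?F" using lam by (simp add: dominated_def)
  have lam': "lam \<in> partitions (n + l - 1)" using lam by (simp add: partitions_ge_def)
  have "standard_specht_polys n l ?F \<subseteq> (specht_ideal n l lam :: 'k mpoly set)"
  proof
    fix p :: "'k mpoly" assume "p \<in> standard_specht_polys n l ?F"
    then obtain mu T where p: "p = specht_poly mu T" "mu \<in> partitions_ge n l" "dominated mu lam" "T \<in> tableaux n l mu"
      unfolding standard_specht_polys_def standard_tableaux_def by blast
    have "mu \<in> partitions (n + l - 1)" using p(2) by (simp add: partitions_ge_def)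
    thus "p \<in> specht_ideal n l lam"
      using specht_ideal_mono[OF n _ lam' p(3)] specht_poly_in_specht_ideal[OF n p(4)] p(1) by blast
  qed
  from ideal_eq_vanishing[OF n l F inf ideal_specht_ideal[OF n] this specht_ideal_sub_vanishing[OF n l F lamF]]
  show ?thesis .
qed

theorem corollary2p7:
  fixes n l :: nat
  assumes "infinite (UNIV :: ('k::field) set)" and "n \<ge> 1" and "l \<ge> 1"
  shows
    "(\<forall>F. lower_filter n l F \<and> F \<subset> partitions_ge n l \<longrightarrow>
        (specht_ideal_filter n l F :: 'k mpoly set)
          = vanishing_ideal n l (partitions_ge n l - F) \<and>
        radical_ideal (specht_ideal_filter n l F :: 'k mpoly set) (poly_ring n)) \<and>
     (\<forall>lam \<in> partitions_ge n l.
        radical_ideal (specht_ideal n l lam :: 'k mpoly set) (poly_ring n) \<and>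
        (specht_ideal n l lam :: 'k mpoly set)
          = {f \<in> carrier (poly_ring n). \<forall>a \<in> affine_space n.
               \<not> dominated (orbit_type n l a) lam \<longrightarrow> eval_mpoly a f = 0} \<and>
        is_groebner_basis n
          {specht_poly mu T | mu T.
             mu \<in> partitions_ge n l \<and> dominated mu lam \<and> T \<in> standard_tableaux n l mu}
          (specht_ideal n l lam :: 'k mpoly set))"
proof (intro conjI allI ballI impI)
  note inf = assms(1) and n = assms(2) and l = assms(3)
  fix F assume "lower_filter n l F \<and> F \<subset> partitions_ge n l"
  hence F: "lower_filter n l F" by blast
  show "(specht_ideal_filter n l F :: 'k mpoly set) = vanishing_ideal n l (partitions_ge n l - F)"
    by (rule specht_ideal_filter_eq_vanishing[OF n l F inf])
  thus "radical_ideal (specht_ideal_filter n l F :: 'k mpoly set) (poly_ring n)"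
    by (simp only: radical_vanishing_ideal)
next
  note inf = assms(1) and n = assms(2) and l = assms(3)
  fix lam assume lam: "lam \<in> partitions_ge n l"
  let ?F = "{mu \<in> partitions_ge n l. dominated mu lam}"
  let ?J = "vanishing_ideal n l (partitions_ge n l - ?F) :: 'k mpoly set"
  have F: "lower_filter n l ?F" by (rule lower_filter_dominated[OF lam])
  have eq: "(specht_ideal n l lam :: 'k mpoly set) = ?J"
    by (rule specht_ideal_eq_vanishing[OF n l inf lam])
  show "radical_ideal (specht_ideal n l lam :: 'k mpoly set) (poly_ring n)"
    unfolding eq by (rule radical_vanishing_ideal)
  show "(specht_ideal n l lam :: 'k mpoly set) = {f \<in> carrier (poly_ring n). \<forall>a \<in> affine_space n.
      \<not> dominated (orbit_type n l a) lam \<longrightarrow> eval_mpoly a f = 0}"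
    unfolding eq vanishing_ideal_def using orbit_type_partitions_ge[OF n l] by auto
  have "?F \<subseteq> partitions (n + l - 1)" by (auto simp: partitions_ge_def)
  from leads_divide_imp_groebner[OF ideal_vanishing standard_specht_polys_vanish[OF n l F]
      standard_specht_leads_divide[OF n l F inf] finite_standard_specht_polys[OF n this]]
  have "is_groebner_basis n (standard_specht_polys n l ?F) (specht_ideal n l lam :: 'k mpoly set)"
    unfolding eq .
  moreover have "(standard_specht_polys n l ?F :: 'k mpoly set) = {specht_poly mu T | mu T.
      mu \<in> partitions_ge n l \<and> dominated mu lam \<and> T \<in> standard_tableaux n l mu}"
    unfolding standard_specht_polys_def by blast
  ultimately show "is_groebner_basis n {specht_poly mu T | mu T.
      mu \<in> partitions_ge n l \<and> dominated mu lam \<and> T \<in> standard_tableaux n l mu}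
    (specht_ideal n l lam :: 'k mpoly set)" by simp
qed

end
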